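(* Let $n\ge2$. An element $S\in\overline U(\mathfrak{br}_n)$ is contained in the group $\overline{\mathbf{Br}}_n$ if and only if $S$ can be represented as a product $$S=T_1T_2\cdots T_{n-1},$$ where, for each $j$, $T_j\in\overline{\mathrm{Asfr}}[r_{j(j+1)},\dots,r_{jn}]$ is an element of the free Lie group $\overline{\mathbf{Fr}}_{n-j}=\overline{\mathbf{Fr}}[r_{j(j+1)},\dots,r_{jn}]$.
   Context: The Kohno Lie algebra $\mathfrak{br}_n$ is the real Lie algebra generated by $r_{ij}=r_{ji}$, $1\le i\ne j\le n$, with relations $[r_{ij},r_{kl}]=0$ for pairwise distinct $i,j,k,l$ and $[r_{ij},r_{ik}+r_{jk}]=0$ for pairwise distinct $i,j,k$. It is graded by $\deg r_{ij}=1$. For a graded real Lie algebra $\mathfrak g=\bigoplus_{k>0}\mathfrak g^{[k]}$ with finite-dimensional components, generated by $\mathfrak g^{[1]}$, the enveloping algebra $U(\mathfrak g)=\bigoplus_{p\ge 0}U(\mathfrak g)^{[p]}$ has the induced grading, $\overline U(\mathfrak g)=\prod_{p\ge0}U(\mathfrak g)^{[p]}$ is the algebra of formal series, $\overline{\mathfrak g}=\prod_{k\ge1}\mathfrak g^{[k]}$, and $\overline{\mathbf G}=\{\exp(x):x\in\overline{\mathfrak g}\}\subset\overline U(\mathfrak g)$, a group under multiplication. For $\mathfrak g=\mathfrak{br}_n$ this group is denoted $\overline{\mathbf{Br}}_n$. For $\mathfrak g$ the free Lie algebra $\mathfrak{fr}[\omega_1,\dots,\omega_m]$ the enveloping algebra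 is the free associative algebra $\mathrm{Asfr}[\omega_1,\dots,\omega_m]$, its completion by formal noncommutative power series is $\overline{\mathrm{Asfr}}[\omega_1,\dots,\omega_m]$, and the group is denoted $\overline{\mathbf{Fr}}_m=\overline{\mathbf{Fr}}[\omega_1,\dots,\omega_m]$. For fixed $j$ the elements $r_{j(j+1)},\dots,r_{jn}$ generate a free associative subalgebra of $U(\mathfrak{br}_n)$, so $\overline{\mathrm{Asfr}}[r_{j(j+1)},\dots,r_{jn}]$ is regarded as a subalgebra of $\overline U(\mathfrak{br}_n)$. *)

theory Defs
  imports "HOL-Analysis.Finite_Function_Topology"
    "HOL-Computational_Algebra.Formal_Power_Series"
    "HOL-Library.Cardinality"
begin

section \<open>Real Lie algebras\<close>

class real_lie_algebra = real_vector +
  fixes lie_bracket :: "'a \<Rightarrow> 'a \<Rightarrow> 'a"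
  assumes lie_bracket_add_left: "lie_bracket (x + y) z = lie_bracket x z + lie_bracket y z"
    and lie_bracket_add_right: "lie_bracket x (y + z) = lie_bracket x y + lie_bracket x z"
    and lie_bracket_scaleR_left: "lie_bracket (c *\<^sub>R x) y = c *\<^sub>R lie_bracket x y"
    and lie_bracket_scaleR_right: "lie_bracket x (c *\<^sub>R y) = c *\<^sub>R lie_bracket x y"
    and lie_bracket_self: "lie_bracket x x = 0"
    and lie_bracket_jacobi:
      "lie_bracket x (lie_bracket y z) + lie_bracket y (lie_bracket z x)
         + lie_bracket z (lie_bracket x y) = 0"

definition commutator :: "'a::ring \<Rightarrow> 'a \<Rightarrow> 'a" where
  "commutator a b = a * b - b * a"

definition lie_subalgebra :: "'a::real_algebra set \<Rightarrow> bool" where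
  "lie_subalgebra L \<longleftrightarrow> subspace L \<and> (\<forall>x\<in>L. \<forall>y\<in>L. commutator x y \<in> L)"

definition lie_ideal :: "'a::real_algebra set \<Rightarrow> 'a set \<Rightarrow> bool" where
  "lie_ideal L J \<longleftrightarrow> subspace J \<and> (\<forall>x\<in>L. \<forall>y\<in>J. commutator x y \<in> J)"

definition two_sided_ideal :: "'a::real_algebra_1 set \<Rightarrow> 'a set" where
  "two_sided_ideal R = span {a * r * b |a r b. r \<in> R}"

lemma two_sided_ideal_mult:
  assumes "x \<in> two_sided_ideal R"
  shows "c * x \<in> two_sided_ideal R" "x * c \<in> two_sided_ideal R"
proof -
  have "c * x \<in> two_sided_ideal R \<and> x * c \<in> two_sided_ideal R"
    using assms unfolding two_sided_ideal_def
  proof (induction rule: span_induct_alt)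
    case base
    show ?case by (simp add: span_zero)
  next
    case (step s y z)
    then obtain a r b where "y = a * r * b" "r \<in> R" by blast
    then have "c * y = (c * a) * r * b" "y * c = a * r * (b * c)"
      by (simp_all add: mult.assoc)
    with \<open>r \<in> R\<close> have "c * y \<in> span {a * r * b |a r b. r \<in> R}"
      "y * c \<in> span {a * r * b |a r b. r \<in> R}"
      by (blast intro: span_base)+
    then show ?case using step
      by (simp add: distrib_left distrib_right span_add span_scale)
  qed
  then show "c * x \<in> two_sided_ideal R" "x * c \<in> two_sided_ideal R" by auto
qed

section \<open>The free associative algebra and the free Lie algebra\<close>

text \<open>Words are written additively because the product of finitely supported functions is
  the convolution over an additive monoid of keys; addition of words is concatenation and
  is not commutative.\<close>

datatype 'x free_monoid = Word (letters: "'x list")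

instantiation free_monoid :: (type) monoid_add
begin

definition zero_free_monoid :: "'x free_monoid" where
  "zero_free_monoid = Word []"

definition plus_free_monoid :: "'x free_monoid \<Rightarrow> 'x free_monoid \<Rightarrow> 'x free_monoid" where
  "plus_free_monoid v w = Word (letters v @ letters w)"

instance
  by standard (simp_all add: zero_free_monoid_def plus_free_monoid_def)

end

type_synonym 'x asfr = "'x free_monoid \<Rightarrow>\<^sub>0 real"

lemma poly_mapping_induct [case_names single sum]:
  fixes f :: "'a \<Rightarrow>\<^sub>0 'b::ab_group_add"
  assumes single: "\<And>k v. P (Poly_Mapping.single k v)"
    and sum: "\<And>f g. P f \<Longrightarrow> P g \<Longrightarrow> P (f + g)"
  shows "P f"
proof -
  have "P f" if "Poly_Mapping.keys f \<subseteq> A" "finite A" for f and A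
    using that(2,1)
  proof (induction A arbitrary: f rule: finite_induct)
    case empty
    then have "f = Poly_Mapping.single undefined 0" by simp
    then show ?case using single[of undefined 0] by simp
  next
    case (insert a A)
    let ?s = "Poly_Mapping.single a (Poly_Mapping.lookup f a)"
    have "Poly_Mapping.keys (f - ?s) \<subseteq> A"
      using insert.prems
      by (auto simp: in_keys_iff lookup_minus lookup_single when_def split: if_splits)
    then have "P ((f - ?s) + ?s)" by (intro sum insert.IH single)
    then show ?case by simp
  qed
  from this[OF subset_refl finite_keys] show ?thesis .
qed

lemma lookup_scaleR_poly_mapping:
  "Poly_Mapping.lookup (c *\<^sub>R f) k = c *\<^sub>R Poly_Mapping.lookup f k"
proof -
  have "finite {i. c *\<^sub>R Poly_Mapping.lookup f i \<noteq> 0}"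
    by (rule finite_subset[OF _ finite_lookup[of f]]) auto
  then show ?thesis
    by (simp add: scaleR_poly_mapping_def Abs_poly_mapping_inverse)
qed

lemma scaleR_eq_single_mult:
  fixes f :: "'a::monoid_add \<Rightarrow>\<^sub>0 'b::real_algebra_1"
  shows "c *\<^sub>R f = Poly_Mapping.single 0 (of_real c) * f"
    and "c *\<^sub>R f = f * Poly_Mapping.single 0 (of_real c)"
proof -
  have 1: "Poly_Mapping.lookup (Poly_Mapping.single 0 (of_real c) * f) k
            = c *\<^sub>R Poly_Mapping.lookup f k" for k
  proof (induction f rule: poly_mapping_induct)
    case (single l v)
    then show ?case
      by (simp add: mult_single lookup_single scaleR_conv_of_real when_def)
  next
    case (sum f g)
    then show ?case by (simp add: distrib_left lookup_add scaleR_add_right)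
  qed
  have 2: "Poly_Mapping.lookup (f * Poly_Mapping.single 0 (of_real c)) k
            = c *\<^sub>R Poly_Mapping.lookup f k" for k
  proof (induction f rule: poly_mapping_induct)
    case (single l v)
    then show ?case
      by (simp add: mult_single lookup_single scaleR_conv_of_real when_def Reals_of_real)
        (metis mult_scaleR_right mult.right_neutral scaleR_conv_of_real)
  next
    case (sum f g)
    then show ?case by (simp add: distrib_right lookup_add scaleR_add_right)
  qed
  show "c *\<^sub>R f = Poly_Mapping.single 0 (of_real c) * f"
    by (rule poly_mapping_eqI) (simp add: 1 lookup_scaleR_poly_mapping)
  show "c *\<^sub>R f = f * Poly_Mapping.single 0 (of_real c)"
    by (rule poly_mapping_eqI) (simp add: 2 lookup_scaleR_poly_mapping)
qed

instance poly_mapping :: (monoid_add, real_algebra_1) real_algebra_1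
proof
  fix c :: real and f g :: "'a \<Rightarrow>\<^sub>0 'b"
  show "c *\<^sub>R f * g = c *\<^sub>R (f * g)"
    by (simp add: scaleR_eq_single_mult(1) mult.assoc)
  show "f * c *\<^sub>R g = c *\<^sub>R (f * g)"
    by (simp add: scaleR_eq_single_mult(2) mult.assoc)
qed

definition asfr_gen :: "'x \<Rightarrow> 'x asfr" where
  "asfr_gen x = Poly_Mapping.single (Word [x]) 1"

definition asfr_homogeneous :: "nat \<Rightarrow> 'x asfr set" where
  "asfr_homogeneous p = {a. \<forall>w\<in>Poly_Mapping.keys a. length (letters w) = p}"

text \<open>The free Lie algebra on \<open>X\<close>, realised inside its enveloping algebra, the free
  associative algebra, as the Lie subalgebra generated by the letters of \<open>X\<close>.\<close>

definition free_lie :: "'x set \<Rightarrow> 'x asfr set" where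
  "free_lie X = lie_subalgebra hull (asfr_gen ` X)"

definition free_lie_comp :: "'x set \<Rightarrow> nat \<Rightarrow> 'x asfr set" where
  "free_lie_comp X k = free_lie X \<inter> asfr_homogeneous k"

definition asfr_subst :: "('x \<Rightarrow> 'u::real_algebra_1) \<Rightarrow> 'x asfr \<Rightarrow> 'u" where
  "asfr_subst f a =
     (\<Sum>w\<in>Poly_Mapping.keys a. Poly_Mapping.lookup a w *\<^sub>R prod_list (map f (letters w)))"

lemma lie_subalgebra_free_lie: "lie_subalgebra (free_lie X)"
  unfolding free_lie_def
  by (rule hull_in) (auto simp: lie_subalgebra_def intro: subspace_Inter)

lemma asfr_gen_in_free_lie: "x \<in> X \<Longrightarrow> asfr_gen x \<in> free_lie X"
  unfolding free_lie_def by (simp add: hull_inc)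

section \<open>The universal enveloping algebra\<close>

text \<open>\<open>U(\<gg>)\<close> is the free associative algebra on the set \<open>\<gg>\<close> modulo the relations making
  the inclusion of generators linear and turning the bracket into the commutator.\<close>

definition envel_relators :: "'g::real_lie_algebra asfr set" where
  "envel_relators =
     {asfr_gen (x + y) - asfr_gen x - asfr_gen y |x y. True}
     \<union> {asfr_gen (c *\<^sub>R x) - c *\<^sub>R asfr_gen x |c x. True}
     \<union> {commutator (asfr_gen x) (asfr_gen y) - asfr_gen (lie_bracket x y) |x y. True}"

definition envel_rel :: "'g::real_lie_algebra asfr \<Rightarrow> 'g asfr \<Rightarrow> bool" where
  "envel_rel a b \<longleftrightarrow> a - b \<in> two_sided_ideal envel_relators"

lemma subspace_two_sided_ideal: "subspace (two_sided_ideal R)"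
  by (simp add: two_sided_ideal_def subspace_span)

lemma equivp_envel_rel: "equivp (envel_rel :: 'g::real_lie_algebra asfr \<Rightarrow> _)"
proof (rule equivpI)
  show "reflp (envel_rel :: 'g asfr \<Rightarrow> _)"
    by (simp add: reflp_def envel_rel_def subspace_0 subspace_two_sided_ideal)
  show "symp (envel_rel :: 'g asfr \<Rightarrow> _)"
    unfolding symp_def envel_rel_def
    by (metis minus_diff_eq subspace_neg subspace_two_sided_ideal)
  show "transp (envel_rel :: 'g asfr \<Rightarrow> _)"
  proof (rule transpI)
    fix a b c :: "'g asfr"
    assume "envel_rel a b" "envel_rel b c"
    then have "(a - b) + (b - c) \<in> two_sided_ideal envel_relators"
      unfolding envel_rel_def by (rule subspace_add[OF subspace_two_sided_ideal])
    then show "envel_rel a c" by (simp add: envel_rel_def)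
  qed
qed

quotient_type (overloaded) 'g envel = "'g::real_lie_algebra asfr" / envel_rel
  by (rule equivp_envel_rel)

lemma lookup_mult_0:
  fixes a b :: "'x asfr"
  shows "Poly_Mapping.lookup (a * b) 0 = Poly_Mapping.lookup a 0 * Poly_Mapping.lookup b 0"
proof -
  have 0: "v + w = 0 \<longleftrightarrow> v = 0 \<and> w = 0" for v w :: "'x free_monoid"
    by (cases v; cases w) (simp add: zero_free_monoid_def plus_free_monoid_def)
  have *: "Poly_Mapping.lookup (Poly_Mapping.single l v * b) 0
      = Poly_Mapping.lookup (Poly_Mapping.single l v) 0 * Poly_Mapping.lookup b 0" for l and v :: real
  proof (induction b rule: poly_mapping_induct)
    case (single m u)
    then show ?case by (auto simp: mult_single lookup_single when_def 0)
  next
    case (sum f g)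
    then show ?case by (simp add: distrib_left lookup_add)
  qed
  show ?thesis
  proof (induction a rule: poly_mapping_induct)
    case (single l v)
    show ?case by (rule *)
  next
    case (sum f g)
    then show ?case by (simp add: distrib_right lookup_add)
  qed
qed

lemma lookup_0_envel_ideal:
  assumes "a \<in> two_sided_ideal envel_relators"
  shows "Poly_Mapping.lookup a 0 = 0"
proof -
  have gen: "Poly_Mapping.lookup (asfr_gen x) 0 = 0" for x :: 'a
    by (simp add: asfr_gen_def lookup_single zero_free_monoid_def when_def)
  have rel: "Poly_Mapping.lookup r 0 = 0" if "r \<in> envel_relators" for r :: "'a asfr"
    using that
    by (auto simp: envel_relators_def lookup_minus lookup_mult_0 gen commutator_def
        lookup_scaleR_poly_mapping)
  show ?thesis
    using assms unfolding two_sided_ideal_def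
  proof (induction rule: span_induct_alt)
    case base
    show ?case by simp
  next
    case (step c x y)
    then show ?case
      by (auto simp: lookup_add lookup_scaleR_poly_mapping lookup_mult_0 rel)
  qed
qed

instantiation envel :: (real_lie_algebra) real_algebra_1
begin

lift_definition zero_envel :: "'a envel" is 0 .

lift_definition one_envel :: "'a envel" is 1 .

lift_definition plus_envel :: "'a envel \<Rightarrow> 'a envel \<Rightarrow> 'a envel" is "(+)"
  unfolding envel_rel_def
  by (metis add_diff_add subspace_add subspace_two_sided_ideal)

lift_definition minus_envel :: "'a envel \<Rightarrow> 'a envel \<Rightarrow> 'a envel" is "(-)"
proof -
  fix a b c d :: "'a asfr"
  assume "envel_rel a b" "envel_rel c d"
  then have "(a - b) - (c - d) \<in> two_sided_ideal envel_relators"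
    unfolding envel_rel_def by (rule subspace_diff[OF subspace_two_sided_ideal])
  then show "envel_rel (a - c) (b - d)"
    by (simp add: envel_rel_def algebra_simps)
qed

lift_definition uminus_envel :: "'a envel \<Rightarrow> 'a envel" is "uminus"
proof -
  fix a b :: "'a asfr"
  assume "envel_rel a b"
  then have "- (a - b) \<in> two_sided_ideal envel_relators"
    unfolding envel_rel_def by (rule subspace_neg[OF subspace_two_sided_ideal])
  then show "envel_rel (- a) (- b)"
    by (simp add: envel_rel_def)
qed

lift_definition times_envel :: "'a envel \<Rightarrow> 'a envel \<Rightarrow> 'a envel" is "(*)"
proof -
  fix a b c d :: "'a asfr"
  assume "envel_rel a b" "envel_rel c d"
  then have "(a - b) * c \<in> two_sided_ideal envel_relators"
    and "b * (c - d) \<in> two_sided_ideal envel_relators"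
    unfolding envel_rel_def by (simp_all add: two_sided_ideal_mult)
  then have "(a - b) * c + b * (c - d) \<in> two_sided_ideal envel_relators"
    by (rule subspace_add[OF subspace_two_sided_ideal])
  then show "envel_rel (a * c) (b * d)"
    by (simp add: envel_rel_def algebra_simps)
qed

lift_definition scaleR_envel :: "real \<Rightarrow> 'a envel \<Rightarrow> 'a envel" is "scaleR"
proof -
  fix r and a b :: "'a asfr"
  assume "envel_rel a b"
  then have "r *\<^sub>R (a - b) \<in> two_sided_ideal envel_relators"
    unfolding envel_rel_def by (rule subspace_scale[OF subspace_two_sided_ideal])
  then show "envel_rel (r *\<^sub>R a) (r *\<^sub>R b)"
    by (simp add: envel_rel_def scaleR_diff_right)
qed

instance
proof
  have eq: "envel_rel a b" if "a = b" for a b :: "'a asfr"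
    using that equivp_reflp[OF equivp_envel_rel] by simp
  fix a b c :: "'a envel" and r s :: real
  show "a + b + c = a + (b + c)" by transfer (simp add: eq add.assoc)
  show "a + b = b + a" by transfer (simp add: eq add.commute)
  show "0 + a = a" by transfer (simp add: eq)
  show "- a + a = 0" by transfer (simp add: eq)
  show "a - b = a + - b" by transfer (simp add: eq)
  show "a * b * c = a * (b * c)" by transfer (simp add: eq mult.assoc)
  show "(a + b) * c = a * c + b * c" by transfer (simp add: eq distrib_right)
  show "a * (b + c) = a * b + a * c" by transfer (simp add: eq distrib_left)
  show "1 * a = a" by transfer (simp add: eq)
  show "a * 1 = a" by transfer (simp add: eq)
  show "r *\<^sub>R (a + b) = r *\<^sub>R a + r *\<^sub>R b" by transfer (simp add: eq scaleR_add_right)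
  show "(r + s) *\<^sub>R a = r *\<^sub>R a + s *\<^sub>R a" by transfer (simp add: eq scaleR_add_left)
  show "r *\<^sub>R s *\<^sub>R a = (r * s) *\<^sub>R a" by transfer (simp add: eq)
  show "1 *\<^sub>R a = a" by transfer (simp add: eq)
  show "r *\<^sub>R a * b = r *\<^sub>R (a * b)" by transfer (simp add: eq)
  show "a * r *\<^sub>R b = r *\<^sub>R (a * b)" by transfer (simp add: eq)
  show "(0::'a envel) \<noteq> 1"
  proof transfer
    show "\<not> envel_rel (0::'a asfr) 1"
      unfolding envel_rel_def using lookup_0_envel_ideal[of "0 - 1 :: 'a asfr"]
      by (auto simp: lookup_minus)
  qed
qed

end

lift_definition envel_of :: "'g::real_lie_algebra \<Rightarrow> 'g envel" is asfr_gen .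

lemma envel_of_bracket:
  "envel_of (lie_bracket x y) = commutator (envel_of x) (envel_of y)"
proof -
  have "asfr_gen x * asfr_gen y - asfr_gen y * asfr_gen x - asfr_gen (lie_bracket x y)
          = 1 * (commutator (asfr_gen x) (asfr_gen y) - asfr_gen (lie_bracket x y)) * 1"
    by (simp add: commutator_def)
  also have "\<dots> \<in> two_sided_ideal envel_relators"
    unfolding two_sided_ideal_def envel_relators_def by (intro span_base) blast
  finally have "envel_rel (asfr_gen x * asfr_gen y - asfr_gen y * asfr_gen x)
      (asfr_gen (lie_bracket x y))"
    by (simp add: envel_rel_def)
  then have "commutator (envel_of x) (envel_of y) = envel_of (lie_bracket x y)"
    unfolding commutator_def by transfer
  then show ?thesis by simp
qed

section \<open>Completions and the group of exponentials\<close>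

text \<open>Below, \<open>gr k\<close> is the component \<open>\<gg>\<^sup>[\<^sup>k\<^sup>]\<close>, \<open>k \<ge> 1\<close>, of a graded Lie algebra. A formal series
  \<open>\<Sum>\<^sub>p u\<^sub>p\<close> in \<open>\<Prod>\<^sub>p U(\<gg>)\<^sup>[\<^sup>p\<^sup>]\<close> is encoded by the power series with \<open>p\<close>-th coefficient \<open>u\<^sub>p\<close>;
  the Cauchy product of power series then is the product of the completed algebra.\<close>

definition envel_comp :: "(nat \<Rightarrow> 'g::real_lie_algebra set) \<Rightarrow> nat \<Rightarrow> 'g envel set" where
  "envel_comp gr p =
     span {prod_list (map envel_of xs) |xs ks.
             list_all2 (\<lambda>x k. k \<ge> 1 \<and> x \<in> gr k) xs ks \<and> sum_list ks = p}"

definition graded_completion :: "(nat \<Rightarrow> 'u::real_algebra_1 set) \<Rightarrow> 'u fps set" where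
  "graded_completion C = {S. \<forall>p. fps_nth S p \<in> C p}"

definition lie_completion :: "(nat \<Rightarrow> 'u::real_algebra_1 set) \<Rightarrow> 'u fps set" where
  "lie_completion L = {x. fps_nth x 0 = 0 \<and> (\<forall>k\<ge>1. fps_nth x k \<in> L k)}"

text \<open>If \<open>x\<close> has no constant term, \<open>x\<^sup>k\<close> has no terms of degree below \<open>k\<close>, so in degree \<open>p\<close>
  the exponential series stops at \<open>k = p\<close>.\<close>

definition series_exp :: "'u::real_algebra_1 fps \<Rightarrow> 'u fps" where
  "series_exp x = Abs_fps (\<lambda>p. \<Sum>k\<le>p. fps_nth (x ^ k) p /\<^sub>R fact k)"

definition exp_group :: "(nat \<Rightarrow> 'u::real_algebra_1 set) \<Rightarrow> 'u fps set" where
  "exp_group L = series_exp ` lie_completion L"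

section \<open>The Kohno Lie algebra\<close>

text \<open>The parameter \<open>n\<close> is the cardinality of the type \<open>'n\<close>; the indices are the numbers
  \<open>1, \<dots>, n\<close>. The letter \<open>(i, j)\<close> stands for the generator \<open>r\<^sub>i\<^sub>j\<close>.\<close>

definition kohno_letters :: "nat \<Rightarrow> (nat \<times> nat) set" where
  "kohno_letters n = {(i, j). i \<in> {1..n} \<and> j \<in> {1..n} \<and> i \<noteq> j}"

definition kohno_relators :: "nat \<Rightarrow> (nat \<times> nat) asfr set" where
  "kohno_relators n =
     {asfr_gen (i, j) - asfr_gen (j, i) |i j. {i, j} \<subseteq> {1..n} \<and> i \<noteq> j}
     \<union> {commutator (asfr_gen (i, j)) (asfr_gen (k, l)) |i j k l.
          {i, j, k, l} \<subseteq> {1..n} \<and> distinct [i, j, k, l]}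
     \<union> {commutator (asfr_gen (i, j)) (asfr_gen (i, k) + asfr_gen (j, k)) |i j k.
          {i, j, k} \<subseteq> {1..n} \<and> distinct [i, j, k]}"

abbreviation kohno_free :: "nat \<Rightarrow> (nat \<times> nat) asfr set" where
  "kohno_free n \<equiv> free_lie (kohno_letters n)"

definition kohno_ideal :: "nat \<Rightarrow> (nat \<times> nat) asfr set" where
  "kohno_ideal n = lie_ideal (kohno_free n) hull kohno_relators n"

definition kohno_coset :: "nat \<Rightarrow> (nat \<times> nat) asfr \<Rightarrow> (nat \<times> nat) asfr set" where
  "kohno_coset n a = {b \<in> kohno_free n. b - a \<in> kohno_ideal n}"

typedef 'n kohno = "kohno_coset CARD('n) ` kohno_free CARD('n)"
  using lie_subalgebra_free_lie[of "kohno_letters CARD('n)"]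
  by (auto simp: lie_subalgebra_def dest: subspace_0)

definition kohno_class :: "(nat \<times> nat) asfr \<Rightarrow> 'n kohno" where
  "kohno_class a = Abs_kohno (kohno_coset CARD('n) a)"

definition kohno_rep :: "'n kohno \<Rightarrow> (nat \<times> nat) asfr" where
  "kohno_rep x = (SOME a. a \<in> Rep_kohno x)"

lemma lie_ideal_kohno_ideal: "lie_ideal (kohno_free n) (kohno_ideal n)"
  unfolding kohno_ideal_def
  by (rule hull_in) (auto simp: lie_ideal_def intro: subspace_Inter)

lemma subspace_kohno_ideal: "subspace (kohno_ideal n)"
  using lie_ideal_kohno_ideal by (simp add: lie_ideal_def)

lemma subspace_kohno_free: "subspace (kohno_free n)"
  using lie_subalgebra_free_lie[of "kohno_letters n"] by (simp add: lie_subalgebra_def)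

lemma commutator_kohno_free:
  "a \<in> kohno_free n \<Longrightarrow> b \<in> kohno_free n \<Longrightarrow> commutator a b \<in> kohno_free n"
  using lie_subalgebra_free_lie[of "kohno_letters n"] by (simp add: lie_subalgebra_def)

lemma commutator_kohno_ideal:
  assumes "a \<in> kohno_free n" "b \<in> kohno_ideal n"
  shows "commutator a b \<in> kohno_ideal n" "commutator b a \<in> kohno_ideal n"
proof -
  show 1: "commutator a b \<in> kohno_ideal n"
    using lie_ideal_kohno_ideal assms by (simp add: lie_ideal_def)
  have "commutator b a = - commutator a b" by (simp add: commutator_def)
  then show "commutator b a \<in> kohno_ideal n"
    using 1 subspace_neg[OF subspace_kohno_ideal] by metis
qed

lemma kohno_class_eq_iff:
  assumes "a \<in> kohno_free CARD('n)" "b \<in> kohno_free CARD('n)"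
  shows "(kohno_class a :: 'n kohno) = kohno_class b \<longleftrightarrow> a - b \<in> kohno_ideal CARD('n)"
proof -
  have "kohno_class a = (kohno_class b :: 'n kohno)
      \<longleftrightarrow> kohno_coset CARD('n) a = kohno_coset CARD('n) b"
    unfolding kohno_class_def using assms by (simp add: Abs_kohno_inject)
  also have "\<dots> \<longleftrightarrow> a - b \<in> kohno_ideal CARD('n)"
  proof
    assume "kohno_coset CARD('n) a = kohno_coset CARD('n) b"
    moreover have "a \<in> kohno_coset CARD('n) a"
      using assms by (simp add: kohno_coset_def subspace_0 subspace_kohno_ideal)
    ultimately show "a - b \<in> kohno_ideal CARD('n)" by (simp add: kohno_coset_def)
  next
    assume ab: "a - b \<in> kohno_ideal CARD('n)"
    have "c - a \<in> kohno_ideal CARD('n) \<longleftrightarrow> c - b \<in> kohno_ideal CARD('n)" for c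
      using subspace_add[OF subspace_kohno_ideal, of "c - a" _ "a - b"]
        subspace_diff[OF subspace_kohno_ideal, of "c - b" _ "a - b"] ab by auto
    then show "kohno_coset CARD('n) a = kohno_coset CARD('n) b"
      by (simp add: kohno_coset_def)
  qed
  finally show ?thesis .
qed

lemma kohno_rep: "kohno_rep x \<in> kohno_free CARD('n)" "kohno_class (kohno_rep x) = x"
  for x :: "'n kohno"
proof -
  obtain a where a: "a \<in> kohno_free CARD('n)" "Rep_kohno x = kohno_coset CARD('n) a"
    using Rep_kohno[of x] by blast
  then have "a \<in> Rep_kohno x"
    by (simp add: kohno_coset_def subspace_0 subspace_kohno_ideal)
  then have "kohno_rep x \<in> Rep_kohno x" unfolding kohno_rep_def by (rule someI)
  with a have *: "kohno_rep x \<in> kohno_free CARD('n)" "kohno_rep x - a \<in> kohno_ideal CARD('n)"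
    by (simp_all add: kohno_coset_def)
  show "kohno_rep x \<in> kohno_free CARD('n)" by fact
  have "kohno_class (kohno_rep x) = (kohno_class a :: 'n kohno)"
    using * a by (simp add: kohno_class_eq_iff)
  also have "\<dots> = x" unfolding kohno_class_def by (simp flip: a(2) add: Rep_kohno_inverse)
  finally show "kohno_class (kohno_rep x) = x" .
qed

lemma kohno_rep_class:
  assumes "a \<in> kohno_free CARD('n)"
  shows "kohno_rep (kohno_class a :: 'n kohno) - a \<in> kohno_ideal CARD('n)"
  using kohno_rep[of "kohno_class a :: 'n kohno"] assms
  by (simp flip: kohno_class_eq_iff)

lemma kohno_cases:
  obtains a where "a \<in> kohno_free CARD('n)" "(x :: 'n kohno) = kohno_class a"
  using kohno_rep by metis

instantiation kohno :: (type) real_lie_algebra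
begin

definition zero_kohno :: "'a kohno" where
  "0 = kohno_class 0"

definition plus_kohno :: "'a kohno \<Rightarrow> 'a kohno \<Rightarrow> 'a kohno" where
  "x + y = kohno_class (kohno_rep x + kohno_rep y)"

definition minus_kohno :: "'a kohno \<Rightarrow> 'a kohno \<Rightarrow> 'a kohno" where
  "x - y = kohno_class (kohno_rep x - kohno_rep y)"

definition uminus_kohno :: "'a kohno \<Rightarrow> 'a kohno" where
  "- x = kohno_class (- kohno_rep x)"

definition scaleR_kohno :: "real \<Rightarrow> 'a kohno \<Rightarrow> 'a kohno" where
  "c *\<^sub>R x = kohno_class (c *\<^sub>R kohno_rep x)"

definition lie_bracket_kohno :: "'a kohno \<Rightarrow> 'a kohno \<Rightarrow> 'a kohno" where
  "lie_bracket x y = kohno_class (commutator (kohno_rep x) (kohno_rep y))"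

lemma kohno_class_uminus_scaleR:
  assumes a: "a \<in> kohno_free CARD('a)"
  shows "(- kohno_class a :: 'a kohno) = kohno_class (- a)"
    and "(c *\<^sub>R kohno_class a :: 'a kohno) = kohno_class (c *\<^sub>R a)"
proof -
  let ?J = "kohno_ideal CARD('a)"
  define a' where "a' = kohno_rep (kohno_class a :: 'a kohno)"
  have F: "a' \<in> kohno_free CARD('a)" and J: "a' - a \<in> ?J"
    by (simp_all add: a'_def kohno_rep kohno_rep_class a)
  note S = subspace_kohno_free subspace_kohno_ideal
  have "- a' - - a \<in> ?J" using subspace_neg[OF S(2) J] by simp
  then show "(- kohno_class a :: 'a kohno) = kohno_class (- a)"
    unfolding uminus_kohno_def a'_def[symmetric]
    by (subst kohno_class_eq_iff) (auto intro: subspace_neg S a F)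
  have "c *\<^sub>R a' - c *\<^sub>R a \<in> ?J"
    using subspace_scale[OF S(2) J, of c] by (simp add: scaleR_diff_right)
  then show "(c *\<^sub>R kohno_class a :: 'a kohno) = kohno_class (c *\<^sub>R a)"
    unfolding scaleR_kohno_def a'_def[symmetric]
    by (subst kohno_class_eq_iff) (auto intro: subspace_scale S a F)
qed

lemma kohno_class_binary:
  assumes a: "a \<in> kohno_free CARD('a)" and b: "b \<in> kohno_free CARD('a)"
  shows "(kohno_class a + kohno_class b :: 'a kohno) = kohno_class (a + b)"
    and "(kohno_class a - kohno_class b :: 'a kohno) = kohno_class (a - b)"
    and "(lie_bracket (kohno_class a) (kohno_class b) :: 'a kohno)
           = kohno_class (commutator a b)"
proof -
  let ?J = "kohno_ideal CARD('a)"
  define a' b' where "a' = kohno_rep (kohno_class a :: 'a kohno)"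
    and "b' = kohno_rep (kohno_class b :: 'a kohno)"
  have F: "a' \<in> kohno_free CARD('a)" "b' \<in> kohno_free CARD('a)"
    by (simp_all add: a'_def b'_def kohno_rep)
  have J: "a' - a \<in> ?J" "b' - b \<in> ?J"
    by (simp_all add: a'_def b'_def kohno_rep_class a b)
  note S = subspace_kohno_free subspace_kohno_ideal
  have "(a' - a) + (b' - b) \<in> ?J" by (rule subspace_add[OF S(2) J])
  then have "(a' + b') - (a + b) \<in> ?J" by (simp add: algebra_simps)
  then show "(kohno_class a + kohno_class b :: 'a kohno) = kohno_class (a + b)"
    unfolding plus_kohno_def a'_def[symmetric] b'_def[symmetric]
    by (subst kohno_class_eq_iff) (auto intro: subspace_add S a b F)
  have "(a' - a) - (b' - b) \<in> ?J" by (rule subspace_diff[OF S(2) J])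
  then have "(a' - b') - (a - b) \<in> ?J" by (simp add: algebra_simps)
  then show "(kohno_class a - kohno_class b :: 'a kohno) = kohno_class (a - b)"
    unfolding minus_kohno_def a'_def[symmetric] b'_def[symmetric]
    by (subst kohno_class_eq_iff) (auto intro: subspace_diff S a b F)
  have "commutator (a' - a) b' + commutator a (b' - b) \<in> ?J"
    by (rule subspace_add[OF S(2) commutator_kohno_ideal(2)[OF F(2) J(1)]
          commutator_kohno_ideal(1)[OF a J(2)]])
  then have "commutator a' b' - commutator a b \<in> ?J"
    by (simp add: commutator_def algebra_simps)
  then show "(lie_bracket (kohno_class a) (kohno_class b) :: 'a kohno)
      = kohno_class (commutator a b)"
    unfolding lie_bracket_kohno_def a'_def[symmetric] b'_def[symmetric]
    by (subst kohno_class_eq_iff) (auto intro: commutator_kohno_free a b F)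
qed

lemmas kohno_class_ops = kohno_class_binary kohno_class_uminus_scaleR

instance
proof
  note S = subspace_add[OF subspace_kohno_free] subspace_diff[OF subspace_kohno_free]
    subspace_neg[OF subspace_kohno_free] subspace_scale[OF subspace_kohno_free]
    subspace_0[OF subspace_kohno_free] commutator_kohno_free
  fix x y z :: "'a kohno" and r s :: real
  obtain a b c where F: "a \<in> kohno_free CARD('a)" "b \<in> kohno_free CARD('a)"
      "c \<in> kohno_free CARD('a)"
    and xyz: "x = kohno_class a" "y = kohno_class b" "z = kohno_class c"
    by (metis kohno_cases)
  note simps = xyz kohno_class_ops zero_kohno_def S F algebra_simps
  show "x + y + z = x + (y + z)" by (simp add: simps)
  show "x + y = y + x" by (simp add: simps)
  show "0 + x = x" by (simp add: simps)
  show "- x + x = 0" by (simp add: simps)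
  show "x - y = x + - y" by (simp add: simps)
  show "r *\<^sub>R (x + y) = r *\<^sub>R x + r *\<^sub>R y" by (simp add: simps)
  show "(r + s) *\<^sub>R x = r *\<^sub>R x + s *\<^sub>R x" by (simp add: simps)
  show "r *\<^sub>R s *\<^sub>R x = (r * s) *\<^sub>R x" by (simp add: simps)
  show "1 *\<^sub>R x = x" by (simp add: simps)
  show "lie_bracket (x + y) z = lie_bracket x z + lie_bracket y z"
    by (simp add: xyz kohno_class_ops S F) (simp add: commutator_def algebra_simps)
  show "lie_bracket x (y + z) = lie_bracket x y + lie_bracket x z"
    by (simp add: xyz kohno_class_ops S F) (simp add: commutator_def algebra_simps)
  show "lie_bracket (r *\<^sub>R x) y = r *\<^sub>R lie_bracket x y"
    by (simp add: xyz kohno_class_ops S F) (simp add: commutator_def algebra_simps)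
  show "lie_bracket x (r *\<^sub>R y) = r *\<^sub>R lie_bracket x y"
    by (simp add: xyz kohno_class_ops S F) (simp add: commutator_def algebra_simps)
  show "lie_bracket x x = 0"
    by (simp add: xyz kohno_class_ops S F zero_kohno_def) (simp add: commutator_def)
  show "lie_bracket x (lie_bracket y z) + lie_bracket y (lie_bracket z x)
      + lie_bracket z (lie_bracket x y) = 0"
    by (simp add: xyz kohno_class_ops S F zero_kohno_def)
      (simp add: commutator_def algebra_simps)
qed

end

text \<open>Only meaningful for distinct \<open>i\<close>, \<open>j\<close> in \<open>{1..n}\<close>.\<close>

definition kohno_gen :: "nat \<Rightarrow> nat \<Rightarrow> 'n kohno" where
  "kohno_gen i j = kohno_class (asfr_gen (i, j))"

lemma kohno_gen_relations:
  fixes i j k l :: nat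
  shows "\<lbrakk>{i, j} \<subseteq> {1..CARD('n)}; i \<noteq> j\<rbrakk> \<Longrightarrow> (kohno_gen i j :: 'n kohno) = kohno_gen j i"
    and "\<lbrakk>{i, j, k, l} \<subseteq> {1..CARD('n)}; distinct [i, j, k, l]\<rbrakk>
      \<Longrightarrow> lie_bracket (kohno_gen i j) (kohno_gen k l :: 'n kohno) = 0"
    and "\<lbrakk>{i, j, k} \<subseteq> {1..CARD('n)}; distinct [i, j, k]\<rbrakk>
      \<Longrightarrow> lie_bracket (kohno_gen i j) (kohno_gen i k + kohno_gen j k :: 'n kohno) = 0"
proof -
  note S = subspace_add[OF subspace_kohno_free] subspace_0[OF subspace_kohno_free]
    commutator_kohno_free
  have gen: "asfr_gen (i, j) \<in> kohno_free CARD('n)"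
    if "i \<in> {1..CARD('n)}" "j \<in> {1..CARD('n)}" "i \<noteq> j" for i j
    using that by (intro asfr_gen_in_free_lie) (simp add: kohno_letters_def)
  have rel: "a \<in> kohno_ideal CARD('n)" if "a \<in> kohno_relators CARD('n)" for a
    using that unfolding kohno_ideal_def by (rule hull_inc)
  show "(kohno_gen i j :: 'n kohno) = kohno_gen j i"
    if "{i, j} \<subseteq> {1..CARD('n)}" "i \<noteq> j"
    unfolding kohno_gen_def using that
    by (subst kohno_class_eq_iff) (auto intro!: gen rel simp: kohno_relators_def)
  show "lie_bracket (kohno_gen i j) (kohno_gen k l :: 'n kohno) = 0"
    if "{i, j, k, l} \<subseteq> {1..CARD('n)}" "distinct [i, j, k, l]"
  proof -
    have "commutator (asfr_gen (i, j)) (asfr_gen (k, l)) \<in> kohno_ideal CARD('n)"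
      using that by (intro rel) (unfold kohno_relators_def, blast)
    then show ?thesis
      unfolding kohno_gen_def zero_kohno_def using that
      by (simp add: kohno_class_ops gen S kohno_class_eq_iff)
  qed
  show "lie_bracket (kohno_gen i j) (kohno_gen i k + kohno_gen j k :: 'n kohno) = 0"
    if "{i, j, k} \<subseteq> {1..CARD('n)}" "distinct [i, j, k]"
  proof -
    have "commutator (asfr_gen (i, j)) (asfr_gen (i, k) + asfr_gen (j, k)) \<in> kohno_ideal CARD('n)"
      using that by (intro rel) (unfold kohno_relators_def, blast)
    then show ?thesis
      unfolding kohno_gen_def zero_kohno_def using that
      by (simp add: kohno_class_ops gen S kohno_class_eq_iff)
  qed
qed

definition kohno_comp :: "nat \<Rightarrow> 'n kohno set" where
  "kohno_comp k = kohno_class ` free_lie_comp (kohno_letters CARD('n)) k"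

definition kohno_envel_completion :: "'n kohno envel fps set" where
  "kohno_envel_completion = graded_completion (envel_comp kohno_comp)"

definition Br_group :: "'n kohno envel fps set" where
  "Br_group = exp_group (\<lambda>k. envel_of ` kohno_comp k)"

definition Fr_group :: "'x set \<Rightarrow> 'x asfr fps set" where
  "Fr_group X = exp_group (free_lie_comp X)"

text \<open>The map of formal noncommutative series in letters \<open>(j, k)\<close> to the completed enveloping
  algebra that sends \<open>(j, k)\<close> to \<open>r\<^sub>j\<^sub>k\<close>.\<close>

definition asfr_to_kohno :: "(nat \<times> nat) asfr fps \<Rightarrow> 'n kohno envel fps" where
  "asfr_to_kohno t =
     Abs_fps (\<lambda>p. asfr_subst (\<lambda>(j, k). envel_of (kohno_gen j k)) (fps_nth t p))"

text \<open>The group \<open>Fr[r\<^sub>j\<^sub>(\<^sub>j\<^sub>+\<^sub>1\<^sub>), \<dots>, r\<^sub>j\<^sub>n]\<close> viewed inside the completed enveloping algebra.\<close>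

definition Fr_in_kohno :: "nat \<Rightarrow> 'n kohno envel fps set" where
  "Fr_in_kohno j = asfr_to_kohno ` Fr_group {(j, k) |k. j < k \<and> k \<le> CARD('n)}"

end

theory Submission
  imports Defs
begin

text \<open>Let \<open>D\<close> be the degree derivation of formal series and let \<open>L\<close> be a graded Lie algebra
  inside an associative algebra. From \<open>D e\<^sup>x = e\<^sup>x (D x - [x, D x] / 2! + [x, [x, D x]] / 3! - \<dots>)\<close>,
  whose degree \<open>p\<close> part is \<open>p x\<^sub>p\<close> plus brackets of lower terms, one sees that \<open>S\<close> lies in the
  group of exponentials of \<open>L\<close> iff it has constant term 1 and \<open>D S = S v\<close> with \<open>v\<close> in the completion
  of \<open>L\<close>. This replaces the Baker-Campbell-Hausdorff formula: if \<open>D S = S v\<close> and \<open>D T = T w\<close> then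
  \<open>D (S T) = S T (T\<^sup>-\<^sup>1 v T + w)\<close>.

  Let \<open>L\<^sub>j\<close> be the Lie algebra generated by \<open>r\<^sub>j\<^sub>k\<close>, \<open>k > j\<close>. The Kohno relations give
  \<open>[L\<^sub>j, L\<^sub>i] \<subseteq> L\<^sub>i\<close> for \<open>i < j\<close>, so \<open>br\<^sub>n\<close> is the sum of the \<open>L\<^sub>j\<close>. Given \<open>D S = S v\<close>, write
  \<open>v = v\<^sub>1 + \<dots> + v\<^sub>n\<^sub>-\<^sub>1\<close> and solve \<open>D T\<^sub>j = T\<^sub>j (R v\<^sub>j R\<^sup>-\<^sup>1)\<close> with \<open>R = T\<^sub>j\<^sub>+\<^sub>1 \<dots> T\<^sub>n\<^sub>-\<^sub>1\<close>, for \<open>j\<close>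
  decreasing; conjugation by \<open>R\<close> preserves \<open>L\<^sub>j\<close>. Then \<open>T\<^sub>1 \<dots> T\<^sub>n\<^sub>-\<^sub>1\<close> solves the same equation as \<open>S\<close>.\<close>

section \<open>Formal power series over a real algebra\<close>

instantiation fps :: (real_vector) real_vector
begin

definition scaleR_fps :: "real \<Rightarrow> 'a fps \<Rightarrow> 'a fps" where
  "c *\<^sub>R f = Abs_fps (\<lambda>n. c *\<^sub>R fps_nth f n)"

instance
  by standard (simp_all add: scaleR_fps_def fps_eq_iff scaleR_add_right scaleR_add_left)

end

lemma fps_scaleR_nth [simp]: "fps_nth (c *\<^sub>R f) n = c *\<^sub>R fps_nth f n"
  by (simp add: scaleR_fps_def)

instance fps :: (real_algebra_1) real_algebra_1
  by standard (simp_all add: fps_eq_iff fps_mult_nth scaleR_sum_right)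

text \<open>Reversing the index in the coefficient of \<open>g * f\<close> pairs the same two
  degrees as in \<open>f * g\<close>, so only brackets of coefficients occur.\<close>

lemma commutator_nth:
  "fps_nth (commutator f g) n = (\<Sum>i\<le>n. commutator (fps_nth f i) (fps_nth g (n - i)))"
proof -
  have "fps_nth (g * f) n = (\<Sum>i\<le>n. fps_nth g (n - i) * fps_nth f i)"
    unfolding fps_mult_nth atLeast0AtMost
    by (rule sum.reindex_bij_witness[of _ "\<lambda>i. n - i" "\<lambda>i. n - i"]) auto
  then show ?thesis
    by (simp add: commutator_def fps_mult_nth atLeast0AtMost sum_subtractf)
qed

definition euler_deriv :: "'a::real_algebra_1 fps \<Rightarrow> 'a fps" where
  "euler_deriv f = Abs_fps (\<lambda>n. real n *\<^sub>R fps_nth f n)"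

lemma euler_deriv_nth [simp]: "fps_nth (euler_deriv f) n = real n *\<^sub>R fps_nth f n"
  by (simp add: euler_deriv_def)

lemma euler_deriv_mult: "euler_deriv (f * g) = euler_deriv f * g + f * euler_deriv g"
proof (rule fps_ext)
  fix n
  have "fps_nth (euler_deriv (f * g)) n
      = (\<Sum>i=0..n. real n *\<^sub>R (fps_nth f i * fps_nth g (n - i)))"
    by (simp add: fps_mult_nth scaleR_sum_right)
  also have "\<dots> = (\<Sum>i=0..n. (real i *\<^sub>R fps_nth f i) * fps_nth g (n - i)
      + fps_nth f i * (real (n - i) *\<^sub>R fps_nth g (n - i)))"
    by (rule sum.cong) (simp_all flip: scaleR_add_left)
  finally show "fps_nth (euler_deriv (f * g)) n
      = fps_nth (euler_deriv f * g + f * euler_deriv g) n"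
    by (simp add: fps_mult_nth sum.distrib)
qed

lemma euler_deriv_linear:
  "euler_deriv (f + g) = euler_deriv f + euler_deriv g"
  "euler_deriv (f - g) = euler_deriv f - euler_deriv g"
  "euler_deriv (c *\<^sub>R f) = c *\<^sub>R euler_deriv f"
  by (simp_all add: fps_eq_iff scaleR_add_right scaleR_diff_right)

text \<open>Induction on the degree: as \<open>v\<close> has no constant term, \<open>n U_n\<close>
  involves only coefficients of \<open>U\<close> below \<open>n\<close>, which vanish.\<close>

lemma euler_deriv_eq_mult_imp_zero:
  assumes "euler_deriv U = U * v" "fps_nth U 0 = 0" "fps_nth v 0 = 0"
  shows "U = 0"
proof -
  have "fps_nth U n = 0" for n
  proof (induction n rule: less_induct)
    case (less n)
    have "real n *\<^sub>R fps_nth U n = fps_nth (U * v) n"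
      by (simp flip: assms(1))
    also have "\<dots> = 0"
      unfolding fps_mult_nth
    proof (rule sum.neutral, rule ballI)
      fix i assume "i \<in> {0..n}"
      then show "fps_nth U i * fps_nth v (n - i) = 0"
        using less.IH[of i] assms(3) by (cases "i = n") auto
    qed
    finally show ?case using assms(2) by (cases "n = 0") auto
  qed
  then show ?thesis by (simp add: fps_eq_iff)
qed

section \<open>The exponential series in an auxiliary variable\<close>

text \<open>Uniqueness for linear equations in the auxiliary variable \<open>t\<close>. The
  exponential identities below follow by applying it to the difference of their two sides.\<close>

lemma fps_deriv_eq_const_mult_imp_zero:
  fixes P :: "'a::real_algebra_1 fps"
  assumes "fps_nth P 0 = 0"
    and "fps_deriv P = fps_const z * P \<or> fps_deriv P = P * fps_const z"
  shows "P = 0"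
proof -
  have "fps_nth P n = 0" for n
  proof (induction n)
    case (Suc n)
    have "real (Suc n) *\<^sub>R fps_nth P (Suc n) = fps_nth (fps_deriv P) n"
      by (simp add: scaleR_conv_of_real)
    also have "\<dots> = 0" using assms(2)
      by (elim disjE) (simp_all only: fps_mult_left_const_nth fps_mult_right_const_nth, simp_all add: Suc)
    finally show ?case by simp
  qed (rule assms)
  then show ?thesis by (simp add: fps_eq_iff)
qed

text \<open>This is \<open>e^(t z)\<close>; likewise \<open>Ad_fps z y\<close> is
  \<open>e^(t ad z) y\<close>, and \<open>integral_fps\<close> integrates from \<open>0\<close> to
  \<open>t\<close>.\<close>

definition exp_fps :: "'a::real_algebra_1 \<Rightarrow> 'a fps" where
  "exp_fps z = Abs_fps (\<lambda>k. z ^ k /\<^sub>R fact k)"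

definition Ad_fps :: "'a::real_algebra_1 \<Rightarrow> 'a \<Rightarrow> 'a fps" where
  "Ad_fps z y = Abs_fps (\<lambda>k. (commutator z ^^ k) y /\<^sub>R fact k)"

definition integral_fps :: "'a::real_algebra_1 fps \<Rightarrow> 'a fps" where
  "integral_fps F = Abs_fps (\<lambda>k. if k = 0 then 0 else fps_nth F (k - 1) /\<^sub>R real k)"

lemma fps_deriv_integral_fps: "fps_deriv (integral_fps F) = F"
proof (rule fps_ext)
  fix n
  have "fps_nth (fps_deriv (integral_fps F)) n
      = real (Suc n) *\<^sub>R (fps_nth F n /\<^sub>R real (Suc n))"
    by (simp only: fps_deriv_nth) (simp add: integral_fps_def scaleR_conv_of_real)
  then show "fps_nth (fps_deriv (integral_fps F)) n = fps_nth F n" by simp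
qed

lemma Suc_times_inverse_fact:
  fixes a :: "'a::real_algebra_1"
  shows "(1 + of_nat n) * (a /\<^sub>R fact (Suc n)) = a /\<^sub>R fact n"
proof -
  have "(1 + of_nat n) * (a /\<^sub>R fact (Suc n)) = real (Suc n) *\<^sub>R (a /\<^sub>R fact (Suc n))"
    by (simp add: scaleR_conv_of_real)
  also have "\<dots> = a /\<^sub>R fact n"
    by (simp add: field_simps del: of_nat_Suc)
  finally show ?thesis .
qed

lemma fps_deriv_exp_fps:
  "fps_deriv (exp_fps z) = fps_const z * exp_fps z"
  "fps_deriv (exp_fps z) = exp_fps z * fps_const z"
proof -
  have *: "fps_nth (fps_deriv (exp_fps z)) n = z ^ Suc n /\<^sub>R fact n" for n
    using Suc_times_inverse_fact[of n "z ^ Suc n"] by (simp add: exp_fps_def del: fact_Suc)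
  show "fps_deriv (exp_fps z) = fps_const z * exp_fps z"
    by (rule fps_ext, subst *) (simp add: exp_fps_def)
  show "fps_deriv (exp_fps z) = exp_fps z * fps_const z"
    by (rule fps_ext, subst *) (simp add: exp_fps_def power_commutes)
qed

lemma fps_deriv_Ad_fps: "fps_deriv (Ad_fps z y) = commutator (fps_const z) (Ad_fps z y)"
proof (rule fps_ext)
  fix n
  show "fps_nth (fps_deriv (Ad_fps z y)) n = fps_nth (commutator (fps_const z) (Ad_fps z y)) n"
    using Suc_times_inverse_fact[of n "(commutator z ^^ Suc n) y"]
    by (simp add: Ad_fps_def commutator_def scaleR_diff_right del: fact_Suc)
qed

text \<open>Both differences vanish at \<open>t = 0\<close>; the first solves
  \<open>P' = P z\<close>, the second \<open>Q' = z Q\<close>.\<close>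

lemma exp_fps_conj:
  "fps_const y * exp_fps z = exp_fps z * Ad_fps (- z) y"
  "exp_fps z * fps_const y = Ad_fps z y * exp_fps z"
proof -
  let ?P = "fps_const y * exp_fps z - exp_fps z * Ad_fps (- z) y"
  have 0: "fps_nth (exp_fps z) 0 = 1" "fps_nth (Ad_fps z y) 0 = y" for z y :: 'a
    by (simp_all add: exp_fps_def Ad_fps_def)
  have "fps_deriv ?P = ?P * fps_const z"
    by (simp add: fps_deriv_exp_fps(2) fps_deriv_Ad_fps commutator_def algebra_simps
        flip: fps_const_neg)
  then have "?P = 0"
    by (intro fps_deriv_eq_const_mult_imp_zero) (auto simp: 0)
  then show "fps_const y * exp_fps z = exp_fps z * Ad_fps (- z) y" by simp
  let ?Q = "exp_fps z * fps_const y - Ad_fps z y * exp_fps z"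
  have "fps_deriv ?Q = fps_const z * ?Q"
    by (simp add: fps_deriv_exp_fps(1) fps_deriv_Ad_fps commutator_def algebra_simps)
  then have "?Q = 0"
    by (intro fps_deriv_eq_const_mult_imp_zero) (auto simp: 0)
  then show "exp_fps z * fps_const y = Ad_fps z y * exp_fps z" by simp
qed

text \<open>Duhamel's formula. With \<open>d\<close> extended to series by treating \<open>t\<close>
  as a constant, both sides vanish at \<open>t = 0\<close> and satisfy
  \<open>P' = d z * e^(t z) + z P\<close>.\<close>

lemma derivation_exp_fps:
  fixes d :: "'a::real_algebra_1 \<Rightarrow> 'a"
  assumes d: "linear d" "\<And>a b. d (a * b) = d a * b + a * d b"
  shows "Abs_fps (\<lambda>k. d (fps_nth (exp_fps z) k))
    = exp_fps z * integral_fps (Ad_fps (- z) (d z))"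
proof -
  define lft :: "'a fps \<Rightarrow> 'a fps" where "lft F = Abs_fps (\<lambda>k. d (fps_nth F k))" for F
  define W where "W = integral_fps (Ad_fps (- z) (d z))"
  have nth: "fps_nth (lft F) k = d (fps_nth F k)" for F k by (simp add: lft_def)
  have lft_mult: "lft (fps_const a * F) = fps_const (d a) * F + fps_const a * lft F" for a F
    by (simp add: fps_eq_iff nth d)
  have lft_deriv: "fps_deriv (lft F) = lft (fps_deriv F)" for F
    using linear_scale[OF d(1), of "real (Suc k)" "fps_nth F (Suc k)" for k]
    by (simp add: fps_eq_iff nth scaleR_conv_of_real)
  let ?P = "lft (exp_fps z) - exp_fps z * W"
  have "fps_deriv ?P = fps_const (d z) * exp_fps z + fps_const z * lft (exp_fps z)
      - exp_fps z * Ad_fps (- z) (d z) - fps_const z * exp_fps z * W"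
    by (simp add: lft_deriv fps_deriv_exp_fps(1) lft_mult W_def fps_deriv_integral_fps)
  also have "\<dots> = fps_const z * ?P"
    by (simp flip: exp_fps_conj(1) add: algebra_simps)
  finally have "?P = 0"
  proof (intro fps_deriv_eq_const_mult_imp_zero disjI1)
    have "d 1 = 0" using d(2)[of 1 1] by simp
    then show "fps_nth ?P 0 = 0" by (simp add: nth exp_fps_def W_def integral_fps_def)
  qed
  then show ?thesis by (simp add: lft_def W_def)
qed

section \<open>Diagonal summation\<close>

text \<open>Sets the auxiliary variable to \<open>1\<close>. Admissibility makes this a finite sum in each degree,
  so that truncating at \<open>k \<le> p\<close> loses nothing.\<close>

definition diag_adm :: "'a::zero fps fps \<Rightarrow> bool" where
  "diag_adm F \<longleftrightarrow> (\<forall>k p. p < k \<longrightarrow> fps_nth (fps_nth F k) p = 0)"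

definition diag_sum :: "'a::comm_monoid_add fps fps \<Rightarrow> 'a fps" where
  "diag_sum F = Abs_fps (\<lambda>p. \<Sum>k\<le>p. fps_nth (fps_nth F k) p)"

lemma diag_sum_mult:
  fixes F G :: "'a::semiring_0 fps fps"
  assumes "diag_adm F" "diag_adm G"
  shows "diag_sum (F * G) = diag_sum F * diag_sum G"
proof (rule fps_ext)
  fix p
  define h where "h i a b = fps_nth (fps_nth F a) i * fps_nth (fps_nth G b) (p - i)" for i a b
  have "fps_nth (diag_sum (F * G)) p = (\<Sum>m\<le>p. \<Sum>a\<le>m. \<Sum>i\<le>p. h i a (m - a))"
    by (simp add: diag_sum_def fps_mult_nth fps_sum_nth h_def atLeast0AtMost)
  also have "\<dots> = (\<Sum>(a, b)\<in>{(a, b). a + b \<le> p}. \<Sum>i\<le>p. h i a b)"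
    by (rule sum.triangle_reindex_eq[symmetric])
  also have "\<dots> = (\<Sum>i\<le>p. \<Sum>(a, b)\<in>{(a, b). a + b \<le> p}. h i a b)"
    by (subst sum.swap) (simp add: case_prod_beta)
  \<comment> \<open>The product of the diagonal sums runs over a rectangle inside the triangle
    \<open>a + b <= p\<close>; admissibility kills the terms outside the rectangle.\<close>
  also have "\<dots> = (\<Sum>i\<le>p. \<Sum>(a, b)\<in>{..i} \<times> {..p - i}. h i a b)"
  proof (rule sum.cong[OF refl])
    fix i assume i: "i \<in> {..p}"
    have h0: "h i a b = 0" if "\<not> (a \<le> i \<and> b \<le> p - i)" for a b
      using assms that by (cases "a \<le> i") (auto simp: h_def diag_adm_def not_le)
    have "finite {(a, b). a + b \<le> p}"
      by (rule finite_subset[of _ "{..p} \<times> {..p}"]) auto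
    then show "(\<Sum>(a, b)\<in>{(a, b). a + b \<le> p}. h i a b) = (\<Sum>(a, b)\<in>{..i} \<times> {..p - i}. h i a b)"
      using i h0 by (intro sum.mono_neutral_right) auto
  qed
  also have "\<dots> = fps_nth (diag_sum F * diag_sum G) p"
    by (simp add: diag_sum_def fps_mult_nth h_def sum_product sum.cartesian_product atLeast0AtMost)
  finally show "fps_nth (diag_sum (F * G)) p = fps_nth (diag_sum F * diag_sum G) p" .
qed

lemma diag_adm_const: "diag_adm (fps_const f)"
  by (simp add: diag_adm_def)

lemma diag_sum_const: "diag_sum (fps_const f) = f"
proof (rule fps_ext)
  fix p
  have "(\<Sum>k\<le>p. fps_nth (fps_nth (fps_const f) k) p) = (\<Sum>k\<in>{0}. fps_nth (fps_nth (fps_const f) k) p)"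
    by (rule sum.mono_neutral_right) auto
  then show "fps_nth (diag_sum (fps_const f)) p = fps_nth f p"
    by (simp add: diag_sum_def)
qed

lemma fps_mult_nth_less_Suc_eq_0:
  fixes f g :: "'a::semiring_0 fps"
  assumes "fps_nth f 0 = 0" "\<And>p. p < k \<Longrightarrow> fps_nth g p = 0" "p < Suc k"
  shows "fps_nth (f * g) p = 0" "fps_nth (g * f) p = 0"
proof -
  have "fps_nth f i * fps_nth g (p - i) = 0" "fps_nth g i * fps_nth f (p - i) = 0"
    if "i \<le> p" for i
    using assms(1) assms(2)[of i] assms(2)[of "p - i"] assms(3) that
    by (cases "i = 0"; cases "i = p"; simp)+
  then show "fps_nth (f * g) p = 0" "fps_nth (g * f) p = 0"
    by (auto simp: fps_mult_nth intro!: sum.neutral)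
qed

lemma diag_adm_exp_fps:
  assumes "fps_nth x 0 = 0"
  shows "diag_adm (exp_fps x)"
proof -
  have "fps_nth (x ^ k) p = 0" if "p < k" for k p
    using that
  proof (induction k arbitrary: p)
    case (Suc k)
    then show ?case using fps_mult_nth_less_Suc_eq_0(1)[OF assms, of k "x ^ k"] by simp
  qed simp
  then show ?thesis by (simp add: diag_adm_def exp_fps_def)
qed

text \<open>Since \<open>y\<close> already starts in degree \<open>1\<close>, \<open>k\<close>
  brackets start in degree \<open>k + 1\<close>. The extra degree pays for the index shift of
  \<open>integral_fps\<close> in \<open>diag_adm_Ad_fps\<close>.\<close>

lemma commutator_funpow_nth_eq_0:
  fixes x y :: "'a::ring fps"
  assumes "fps_nth x 0 = 0" "fps_nth y 0 = 0" "p \<le> k"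
  shows "fps_nth ((commutator x ^^ k) y) p = 0"
  using assms(3)
proof (induction k arbitrary: p)
  case 0
  then show ?case using assms(2) by simp
next
  case (Suc k)
  then show ?case
    using fps_mult_nth_less_Suc_eq_0[OF assms(1), of "Suc k" "(commutator x ^^ k) y" p]
    by (simp add: commutator_def[of x "(commutator x ^^ k) y"])
qed

lemma diag_adm_Ad_fps:
  assumes "fps_nth x 0 = 0" "fps_nth y 0 = 0"
  shows "diag_adm (Ad_fps x y)" "diag_adm (integral_fps (Ad_fps x y))"
  using commutator_funpow_nth_eq_0[OF assms] by (auto simp: diag_adm_def Ad_fps_def integral_fps_def)

lemma series_exp_eq_diag_sum: "series_exp x = diag_sum (exp_fps x)"
  by (simp add: series_exp_def diag_sum_def exp_fps_def)

section \<open>Conjugation by an exponential, and its logarithmic derivative\<close>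

definition exp_Ad :: "'a::real_algebra_1 fps \<Rightarrow> 'a fps \<Rightarrow> 'a fps" where
  "exp_Ad x y = diag_sum (Ad_fps x y)"

text \<open>For \<open>S = e^x\<close> this is \<open>S^(-1) D S\<close>, that is,
  \<open>(1 - e^(-ad x)) / ad x\<close> applied to \<open>D x\<close>.\<close>

definition log_deriv :: "'a::real_algebra_1 fps \<Rightarrow> 'a fps" where
  "log_deriv x = diag_sum (integral_fps (Ad_fps (- x) (euler_deriv x)))"

lemma series_exp_conj:
  assumes "fps_nth x 0 = 0" "fps_nth y 0 = 0"
  shows "y * series_exp x = series_exp x * exp_Ad (- x) y"
    and "series_exp x * y = exp_Ad x y * series_exp x"
proof -
  note adm = diag_adm_exp_fps[OF assms(1)] diag_adm_const
    diag_adm_Ad_fps(1)[OF assms] diag_adm_Ad_fps(1)[of "- x" y]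
  have "diag_sum (fps_const y * exp_fps x) = diag_sum (exp_fps x * Ad_fps (- x) y)"
    by (simp only: exp_fps_conj)
  then show "y * series_exp x = series_exp x * exp_Ad (- x) y"
    by (simp add: diag_sum_mult adm assms diag_sum_const series_exp_eq_diag_sum exp_Ad_def)
  have "diag_sum (exp_fps x * fps_const y) = diag_sum (Ad_fps x y * exp_fps x)"
    by (simp only: exp_fps_conj)
  then show "series_exp x * y = exp_Ad x y * series_exp x"
    by (simp add: diag_sum_mult adm assms diag_sum_const series_exp_eq_diag_sum exp_Ad_def)
qed

lemma series_exp_nth_0: "fps_nth (series_exp x) 0 = 1"
  by (simp add: series_exp_def)

text \<open>\<open>D\<close> acts on each coefficient in \<open>t\<close> and so passes through
  \<open>diag_sum\<close>; Duhamel's formula then applies with \<open>d = D\<close>.\<close>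

lemma euler_deriv_series_exp:
  assumes "fps_nth x 0 = 0"
  shows "euler_deriv (series_exp x) = series_exp x * log_deriv x"
proof -
  have "euler_deriv (diag_sum F) = diag_sum (Abs_fps (\<lambda>k. euler_deriv (fps_nth F k)))"
    for F :: "'a fps fps"
    by (simp add: fps_eq_iff diag_sum_def scaleR_sum_right)
  moreover have "linear (euler_deriv :: 'a fps \<Rightarrow> 'a fps)"
    by (rule linearI) (simp_all add: euler_deriv_linear)
  ultimately have "euler_deriv (series_exp x)
      = diag_sum (exp_fps x * integral_fps (Ad_fps (- x) (euler_deriv x)))"
    by (simp add: series_exp_eq_diag_sum derivation_exp_fps euler_deriv_mult)
  then show ?thesis
    using assms
    by (simp add: diag_sum_mult diag_adm_exp_fps diag_adm_Ad_fps series_exp_eq_diag_sum log_deriv_def)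
qed

text \<open>The terms with at least one bracket; \<open>k\<close> brackets reach degree
  \<open>p\<close> only if \<open>k < p\<close>.\<close>

definition log_deriv_tail :: "'a::real_algebra_1 fps \<Rightarrow> nat \<Rightarrow> 'a" where
  "log_deriv_tail x p =
     (\<Sum>k=1..<p. fps_nth ((commutator (- x) ^^ k) (euler_deriv x)) p /\<^sub>R fact (Suc k))"

lemma log_deriv_nth:
  assumes "p \<ge> 1"
  shows "fps_nth (log_deriv x) p = real p *\<^sub>R fps_nth x p + log_deriv_tail x p"
proof -
  define t where "t k = fps_nth ((commutator (- x) ^^ k) (euler_deriv x)) p /\<^sub>R fact (Suc k)" for k
  have "fps_nth (log_deriv x) p = (\<Sum>k\<le>p. if k = 0 then 0 else t (k - 1))"
    unfolding log_deriv_def diag_sum_def integral_fps_def Ad_fps_def fps_nth_Abs_fps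
    by (rule sum.cong) (auto simp: t_def gr0_conv_Suc)
  also have "\<dots> = (\<Sum>k\<in>{1..p}. t (k - 1))"
    by (rule sum.mono_neutral_cong_right) auto
  also have "\<dots> = (\<Sum>k\<in>{0..<p}. t k)"
    by (rule sum.reindex_bij_witness[of _ Suc "\<lambda>k. k - 1"]) auto
  also have "\<dots> = t 0 + (\<Sum>k=1..<p. t k)"
    using assms by (simp add: sum.atLeast_Suc_lessThan)
  finally show ?thesis by (simp add: t_def log_deriv_tail_def)
qed

lemma log_deriv_nth_0: "fps_nth (log_deriv x) 0 = 0"
  by (simp add: log_deriv_def diag_sum_def integral_fps_def)

text \<open>Agreement below degree \<open>p\<close> extends to degree \<open>p\<close>, because
  there a coefficient of degree \<open>p\<close> meets only a constant term, which is zero.\<close>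

lemma commutator_nth_cong:
  fixes x x' y y' :: "'a::ring fps"
  assumes "fps_nth x 0 = 0" "fps_nth y 0 = 0"
    and "\<And>i. i < p \<Longrightarrow> fps_nth x i = fps_nth x' i"
    and "\<And>i. i < p \<Longrightarrow> fps_nth y i = fps_nth y' i"
    and "fps_nth x' 0 = 0" "fps_nth y' 0 = 0" "q \<le> p"
  shows "fps_nth (commutator x y) q = fps_nth (commutator x' y') q"
  unfolding commutator_nth
proof (rule sum.cong[OF refl])
  fix i assume "i \<in> {..q}"
  then consider "i = 0" | "i = q" | "i < p" "q - i < p" using assms(7) by fastforce
  then show "commutator (fps_nth x i) (fps_nth y (q - i))
      = commutator (fps_nth x' i) (fps_nth y' (q - i))"
    by cases (use assms in \<open>simp_all add: commutator_def\<close>)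
qed

lemma log_deriv_tail_cong:
  assumes "fps_nth x 0 = 0" "fps_nth x' 0 = 0" "\<And>i. i < p \<Longrightarrow> fps_nth x i = fps_nth x' i"
  shows "log_deriv_tail x p = log_deriv_tail x' p"
proof -
  let ?ad = "\<lambda>x k. (commutator (- x) ^^ k) (euler_deriv x)"
  have 0: "fps_nth (?ad x k) 0 = 0" if "fps_nth x 0 = 0" for x :: "'a fps" and k
    using that by (intro commutator_funpow_nth_eq_0) auto
  \<comment> \<open>Stated from the first bracket on: \<open>euler_deriv x\<close> and
    \<open>euler_deriv x'\<close> themselves may differ in degree \<open>p\<close>.\<close>
  have "fps_nth (?ad x (Suc k)) q = fps_nth (?ad x' (Suc k)) q" if "q \<le> p" for k q
    using that
  proof (induction k arbitrary: q)
    case 0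
    then show ?case using assms by (simp, intro commutator_nth_cong[where p = p]) auto
  next
    case (Suc k)
    have "fps_nth (commutator (- x) (?ad x (Suc k))) q
        = fps_nth (commutator (- x') (?ad x' (Suc k))) q"
      using assms Suc by (intro commutator_nth_cong[where p = p] 0) auto
    then show ?case by simp
  qed
  then have "fps_nth (?ad x k) p = fps_nth (?ad x' k) p" if "k \<ge> 1" for k
    using that by (cases k) auto
  then show ?thesis
    unfolding log_deriv_tail_def by (intro sum.cong refl) simp
qed

text \<open>Solves \<open>log_deriv_nth\<close> for the coefficient of degree \<open>p\<close>.
  Truncation below \<open>p\<close> makes the recursion terminate and, by
  \<open>log_deriv_tail_cong\<close>, leaves the tail unchanged.\<close>

fun log_deriv_inv_nth :: "'a::real_algebra_1 fps \<Rightarrow> nat \<Rightarrow> 'a" where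
  "log_deriv_inv_nth v p =
     (if p = 0 then 0
      else (fps_nth v p
        - log_deriv_tail (Abs_fps (\<lambda>q. if q < p then log_deriv_inv_nth v q else 0)) p) /\<^sub>R real p)"

declare log_deriv_inv_nth.simps [simp del]

lemma log_deriv_surj:
  assumes "fps_nth v 0 = 0"
  obtains x where "fps_nth x 0 = 0" "log_deriv x = v"
proof
  define x where "x = Abs_fps (log_deriv_inv_nth v)"
  show x0: "fps_nth x 0 = 0" by (simp add: x_def log_deriv_inv_nth.simps)
  show "log_deriv x = v"
  proof (rule fps_ext)
    fix p
    show "fps_nth (log_deriv x) p = fps_nth v p"
    proof (cases "p = 0")
      case True
      then show ?thesis by (simp add: log_deriv_nth_0 assms)
    next
      case False
      have "log_deriv_tail (Abs_fps (\<lambda>q. if q < p then log_deriv_inv_nth v q else 0)) p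
          = log_deriv_tail x p"
        using x0 by (intro log_deriv_tail_cong) (auto simp: x_def)
      then have "real p *\<^sub>R fps_nth x p = fps_nth v p - log_deriv_tail x p"
        using False by (simp add: x_def log_deriv_inv_nth.simps[of v p])
      then show ?thesis using False by (simp add: log_deriv_nth)
    qed
  qed
qed

section \<open>Graded Lie algebras and their exponential groups\<close>

definition lie_acts :: "(nat \<Rightarrow> 'a::ring set) \<Rightarrow> (nat \<Rightarrow> 'a set) \<Rightarrow> bool" where
  "lie_acts A B \<longleftrightarrow> (\<forall>i j. \<forall>x\<in>A i. \<forall>y\<in>B j. commutator x y \<in> B (i + j))"

definition graded_lie :: "(nat \<Rightarrow> 'a::real_algebra set) \<Rightarrow> bool" where
  "graded_lie L \<longleftrightarrow> (\<forall>k. subspace (L k)) \<and> lie_acts L L"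

lemma lie_completion_iff:
  assumes "\<And>k. subspace (L k)"
  shows "x \<in> lie_completion L \<longleftrightarrow> fps_nth x 0 = 0 \<and> (\<forall>k. fps_nth x k \<in> L k)"
proof -
  have "fps_nth x k \<in> L k" if "fps_nth x 0 = 0" "\<forall>k\<ge>1. fps_nth x k \<in> L k" for k
    using that subspace_0[OF assms] by (cases "k = 0") auto
  then show ?thesis by (auto simp: lie_completion_def)
qed

text \<open>As in \<open>commutator_nth_cong\<close>, knowledge below degree \<open>p\<close>
  suffices in degree \<open>p\<close>; the induction in \<open>log_deriv_mem_iff\<close> rests on
  this gain.\<close>

lemma commutator_nth_mem:
  assumes "lie_acts A B" "\<And>k. subspace (B k)"
    and "fps_nth x 0 = 0" "fps_nth y 0 = 0"
    and "\<And>i. i < p \<Longrightarrow> fps_nth x i \<in> A i" "\<And>i. i < p \<Longrightarrow> fps_nth y i \<in> B i" "q \<le> p"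
  shows "fps_nth (commutator x y) q \<in> B q"
  unfolding commutator_nth
proof (rule subspace_sum[OF assms(2)])
  fix i assume i: "i \<in> {..q}"
  then consider "i = 0" | "i = q" | "i < p" "q - i < p" using assms(7) by fastforce
  then show "commutator (fps_nth x i) (fps_nth y (q - i)) \<in> B q"
  proof cases
    case 3
    then have "commutator (fps_nth x i) (fps_nth y (q - i)) \<in> B (i + (q - i))"
      using assms(1,5,6) unfolding lie_acts_def by blast
    then show ?thesis using i by simp
  qed (use assms(3,4) subspace_0[OF assms(2)] in \<open>simp_all add: commutator_def\<close>)
qed

lemma commutator_funpow_nth_mem:
  assumes "lie_acts A B" "\<And>k. subspace (B k)"
    and "fps_nth x 0 = 0" "fps_nth y 0 = 0"
    and "\<And>i. i < p \<Longrightarrow> fps_nth x i \<in> A i" "\<And>i. i < p \<Longrightarrow> fps_nth y i \<in> B i" "q \<le> p" "k \<ge> 1"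
  shows "fps_nth ((commutator x ^^ k) y) q \<in> B q"
  using assms(8,7)
proof (induction k arbitrary: q rule: nat_induct_at_least)
  case base
  then show ?case using commutator_nth_mem[OF assms(1-6)] by simp
next
  case (Suc k)
  have "fps_nth (commutator x ((commutator x ^^ k) y)) q \<in> B q"
    using assms Suc by (intro commutator_nth_mem[where p = p and A = A] commutator_funpow_nth_eq_0) auto
  then show ?case by simp
qed

lemma exp_Ad_mem:
  assumes "lie_acts A B" "\<And>k. subspace (A k)" "\<And>k. subspace (B k)"
    and "x \<in> lie_completion A" "y \<in> lie_completion B"
  shows "exp_Ad x y \<in> lie_completion B"
proof -
  have xy: "fps_nth x 0 = 0" "fps_nth y 0 = 0" "\<And>i. fps_nth x i \<in> A i" "\<And>i. fps_nth y i \<in> B i"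
    using assms by (simp_all add: lie_completion_iff)
  have "fps_nth ((commutator x ^^ k) y) p \<in> B p" for k p
    using commutator_funpow_nth_mem[OF assms(1,3) xy(1,2), of p p k] xy(3,4) by (cases "k = 0") auto
  then show ?thesis
    using assms(3) xy
    by (auto simp: lie_completion_iff exp_Ad_def diag_sum_def Ad_fps_def
        intro!: subspace_sum subspace_scale)
qed

lemma lie_completion_uminus:
  assumes "\<And>k. subspace (L k)" "x \<in> lie_completion L"
  shows "- x \<in> lie_completion L"
  using assms by (auto simp: lie_completion_iff intro: subspace_neg)

lemma lie_completion_add:
  assumes "\<And>k. subspace (L k)" "x \<in> lie_completion L" "y \<in> lie_completion L"
  shows "x + y \<in> lie_completion L"
  using assms by (auto simp: lie_completion_iff intro: subspace_add)

lemma log_deriv_tail_mem: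
  assumes "graded_lie L" "fps_nth x 0 = 0" "\<And>i. i < p \<Longrightarrow> fps_nth x i \<in> L i"
  shows "log_deriv_tail x p \<in> L p"
proof -
  have L: "lie_acts L L" "\<And>k. subspace (L k)" using assms(1) by (auto simp: graded_lie_def)
  have "fps_nth ((commutator (- x) ^^ k) (euler_deriv x)) p \<in> L p" if "k \<ge> 1" for k
    using that assms(2,3)
    by (intro commutator_funpow_nth_mem[OF L, where p = p])
      (auto intro: subspace_neg subspace_scale L)
  then show ?thesis
    unfolding log_deriv_tail_def by (intro subspace_sum subspace_scale L) auto
qed

text \<open>In degree \<open>p\<close>, \<open>log_deriv x\<close> differs from \<open>p x_p\<close>
  by brackets of lower coefficients of \<open>x\<close>. Membership thus passes both ways, from left
  to right by induction on \<open>p\<close>.\<close>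

lemma log_deriv_mem_iff:
  assumes "graded_lie L" "fps_nth x 0 = 0"
  shows "log_deriv x \<in> lie_completion L \<longleftrightarrow> x \<in> lie_completion L"
proof -
  have L: "\<And>k. subspace (L k)" using assms(1) by (auto simp: graded_lie_def)
  show ?thesis
  proof
    assume v: "log_deriv x \<in> lie_completion L"
    have "fps_nth x p \<in> L p" for p
    proof (induction p rule: less_induct)
      case (less p)
      show ?case
      proof (cases "p = 0")
        case False
        then have "fps_nth x p = (fps_nth (log_deriv x) p - log_deriv_tail x p) /\<^sub>R real p"
          by (simp add: log_deriv_nth)
        also have "\<dots> \<in> L p"
          using v less assms
          by (intro subspace_scale subspace_diff log_deriv_tail_mem L) (auto simp: lie_completion_iff L)
        finally show ?thesis .
      qed (simp add: assms(2) subspace_0 L)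
    qed
    then show "x \<in> lie_completion L" by (simp add: lie_completion_iff L assms(2))
  next
    assume "x \<in> lie_completion L"
    then have "fps_nth x k \<in> L k" for k by (simp add: lie_completion_iff L)
    then show "log_deriv x \<in> lie_completion L"
      unfolding lie_completion_def
      by (simp add: log_deriv_nth_0 log_deriv_nth log_deriv_tail_mem assms subspace_add subspace_scale L)
  qed
qed

lemma euler_deriv_eq_mult_unique:
  assumes "euler_deriv S = S * v" "euler_deriv T = T * v" "fps_nth S 0 = fps_nth T 0" "fps_nth v 0 = 0"
  shows "S = T"
  using euler_deriv_eq_mult_imp_zero[of "S - T" v] assms
  by (simp add: euler_deriv_linear left_diff_distrib)

text \<open>For the converse, \<open>log_deriv\<close> is onto, so \<open>log_deriv x = v\<close>
  for some \<open>x\<close>. Then \<open>S\<close> and \<open>e^x\<close> solve the same equation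
  with constant term \<open>1\<close>, and \<open>x\<close> lies in the completion because
  \<open>v\<close> does.\<close>

lemma exp_group_iff:
  assumes "graded_lie L"
  shows "S \<in> exp_group L \<longleftrightarrow> fps_nth S 0 = 1 \<and> (\<exists>v\<in>lie_completion L. euler_deriv S = S * v)"
proof
  assume "S \<in> exp_group L"
  then obtain x where x: "x \<in> lie_completion L" "S = series_exp x"
    by (auto simp: exp_group_def)
  then have "fps_nth x 0 = 0" by (simp add: lie_completion_def)
  with x show "fps_nth S 0 = 1 \<and> (\<exists>v\<in>lie_completion L. euler_deriv S = S * v)"
    using log_deriv_mem_iff[OF assms, of x] by (auto simp: series_exp_nth_0 euler_deriv_series_exp)
next
  assume "fps_nth S 0 = 1 \<and> (\<exists>v\<in>lie_completion L. euler_deriv S = S * v)"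
  then obtain v where S: "fps_nth S 0 = 1" "v \<in> lie_completion L" "euler_deriv S = S * v"
    by blast
  then have v0: "fps_nth v 0 = 0" by (simp add: lie_completion_def)
  then obtain x where x: "fps_nth x 0 = 0" "log_deriv x = v" by (rule log_deriv_surj)
  have "S = series_exp x"
    by (rule euler_deriv_eq_mult_unique[of _ v])
      (use S v0 x in \<open>simp_all add: euler_deriv_series_exp series_exp_nth_0\<close>)
  then show "S \<in> exp_group L"
    using x S log_deriv_mem_iff[OF assms, of x] by (simp add: exp_group_def)
qed

text \<open>For \<open>S = e^x\<close> the two witnesses are \<open>e^(-ad x) y\<close> and
  \<open>e^(ad x) y\<close>; the equations express conjugation without writing an inverse of
  \<open>S\<close>.\<close>

lemma exp_group_conj:
  assumes "lie_acts A B" "\<And>k. subspace (A k)" "\<And>k. subspace (B k)"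
    and "S \<in> exp_group A" "y \<in> lie_completion B"
  shows "\<exists>w\<in>lie_completion B. y * S = S * w" "\<exists>w\<in>lie_completion B. S * y = w * S"
proof -
  obtain x where x: "x \<in> lie_completion A" "S = series_exp x"
    using assms(4) by (auto simp: exp_group_def)
  have 0: "fps_nth x 0 = 0" "fps_nth y 0 = 0" using x assms by (simp_all add: lie_completion_def)
  have "exp_Ad x y \<in> lie_completion B" "exp_Ad (- x) y \<in> lie_completion B"
    using x assms by (auto intro!: exp_Ad_mem[OF assms(1-3)] lie_completion_uminus)
  then show "\<exists>w\<in>lie_completion B. y * S = S * w" "\<exists>w\<in>lie_completion B. S * y = w * S"
    using series_exp_conj[OF 0] x(2) by auto
qed

lemma one_in_exp_group: "graded_lie L \<Longrightarrow> 1 \<in> exp_group L"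
  by (auto simp: exp_group_iff fps_eq_iff[of "euler_deriv 1"] lie_completion_def graded_lie_def
      subspace_0 intro!: exI[of _ 0])

lemma mult_in_exp_group:
  assumes "graded_lie L" "S \<in> exp_group L" "T \<in> exp_group L"
  shows "S * T \<in> exp_group L"
proof -
  have L: "lie_acts L L" "\<And>k. subspace (L k)" using assms(1) by (auto simp: graded_lie_def)
  obtain v w where vw: "fps_nth S 0 = 1" "v \<in> lie_completion L" "euler_deriv S = S * v"
    "fps_nth T 0 = 1" "w \<in> lie_completion L" "euler_deriv T = T * w"
    using assms by (auto simp: exp_group_iff)
  obtain v' where v': "v' \<in> lie_completion L" "v * T = T * v'"
    using exp_group_conj(1)[OF L(1) L(2) L(2) assms(3) vw(2)] by blast
  have "euler_deriv (S * T) = S * (v * T) + S * T * w"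
    by (simp add: euler_deriv_mult vw mult.assoc)
  also have "\<dots> = S * T * (v' + w)" by (simp add: v' algebra_simps)
  finally show ?thesis
    using lie_completion_add[OF L(2) v'(1) vw(5)] vw by (auto simp: exp_group_iff assms)
qed

lemma exp_group_solve:
  assumes "graded_lie L" "v \<in> lie_completion L"
  obtains T where "T \<in> exp_group L" "euler_deriv T = T * v"
proof -
  have "fps_nth v 0 = 0" using assms(2) by (simp add: lie_completion_def)
  then obtain x where x: "fps_nth x 0 = 0" "log_deriv x = v" by (rule log_deriv_surj)
  then have "x \<in> lie_completion L" using log_deriv_mem_iff[OF assms(1), of x] assms(2) by simp
  with x show ?thesis
    by (intro that[of "series_exp x"]) (auto simp: exp_group_def euler_deriv_series_exp)
qed

section \<open>Ordered products and sums of Lie algebras acting on one another\<close>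

lemma prod_list_exp_group_conj:
  assumes "\<And>i. i \<in> set js \<Longrightarrow> lie_acts (L i) B" "\<And>i. i \<in> set js \<Longrightarrow> graded_lie (L i)"
    and "\<And>k. subspace (B k)" "\<And>i. i \<in> set js \<Longrightarrow> T i \<in> exp_group (L i)" "y \<in> lie_completion B"
  shows "\<exists>w\<in>lie_completion B. prod_list (map T js) * y = w * prod_list (map T js)"
  using assms
proof (induction js)
  case (Cons j js)
  then obtain w where w: "w \<in> lie_completion B"
    "prod_list (map T js) * y = w * prod_list (map T js)" by auto
  obtain w' where w': "w' \<in> lie_completion B" "T j * w = w' * T j"
    using exp_group_conj(2)[of "L j" B "T j" w] Cons.prems w(1) by (auto simp: graded_lie_def)
  have "prod_list (map T (j # js)) * y = T j * w * prod_list (map T js)"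
    by (simp add: mult.assoc w(2))
  also have "\<dots> = w' * prod_list (map T (j # js))" by (simp add: w'(2) mult.assoc)
  finally show ?case using w'(1) by blast
qed auto

lemma exp_group_factor:
  assumes "distinct js" "sorted_wrt (\<lambda>h i. lie_acts (L i) (L h)) js"
    and "\<And>i. i \<in> set js \<Longrightarrow> graded_lie (L i)" "\<And>i. i \<in> set js \<Longrightarrow> v i \<in> lie_completion (L i)"
  shows "\<exists>T. (\<forall>i\<in>set js. T i \<in> exp_group (L i)) \<and> fps_nth (prod_list (map T js)) 0 = 1 \<and>
    euler_deriv (prod_list (map T js)) = prod_list (map T js) * (\<Sum>i\<in>set js. v i)"
  using assms
proof (induction js)
  case Nil
  show ?case by (simp add: fps_eq_iff)
next
  case (Cons j js)
  then obtain T where T: "\<forall>i\<in>set js. T i \<in> exp_group (L i)" "fps_nth (prod_list (map T js)) 0 = 1"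
    "euler_deriv (prod_list (map T js)) = prod_list (map T js) * (\<Sum>i\<in>set js. v i)"
    by auto
  define R where "R = prod_list (map T js)"
  \<comment> \<open>\<open>w\<close> stands for \<open>R v_j R^(-1)\<close>; it stays in the
    completion of \<open>L j\<close> because every algebra later in the list acts on
    \<open>L j\<close>.\<close>
  obtain w where w: "w \<in> lie_completion (L j)" "R * v j = w * R"
    using prod_list_exp_group_conj[of js L "L j" T "v j"] Cons.prems T(1)
    by (auto simp: R_def graded_lie_def)
  obtain U where U: "U \<in> exp_group (L j)" "euler_deriv U = U * w"
    using exp_group_solve[OF Cons.prems(3) w(1)] by auto
  define T' where "T' = T(j := U)"
  have "map T' js = map T js" using Cons.prems(1) by (auto simp: T'_def)
  then have P: "prod_list (map T' (j # js)) = U * R" by (simp only: R_def list.map) (simp add: T'_def)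
  have "euler_deriv (U * R) = U * (w * R) + U * (R * (\<Sum>i\<in>set js. v i))"
    by (simp add: euler_deriv_mult U T R_def mult.assoc)
  also have "\<dots> = U * R * (v j + (\<Sum>i\<in>set js. v i))"
    by (simp add: algebra_simps flip: w(2))
  also have "v j + (\<Sum>i\<in>set js. v i) = (\<Sum>i\<in>set (j # js). v i)"
    using Cons.prems(1) by simp
  finally have "euler_deriv (U * R) = U * R * (\<Sum>i\<in>set (j # js). v i)" .
  moreover have "fps_nth (U * R) 0 = 1"
    using U(1) T(2) Cons.prems(3) by (simp add: exp_group_iff R_def)
  moreover have "\<forall>i\<in>set (j # js). T' i \<in> exp_group (L i)"
    using T(1) U(1) by (simp add: T'_def)
  ultimately show ?case unfolding P[symmetric] by blast
qed

definition lie_sum :: "'i set \<Rightarrow> ('i \<Rightarrow> nat \<Rightarrow> 'a::real_algebra set) \<Rightarrow> nat \<Rightarrow> 'a set" where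
  "lie_sum I L k = {\<Sum>i\<in>I. u i |u. \<forall>i\<in>I. u i \<in> L i k}"

lemma lie_sum_superset:
  assumes "finite I" "\<And>i. i \<in> I \<Longrightarrow> graded_lie (L i)" "i \<in> I"
  shows "L i k \<subseteq> lie_sum I L k"
proof
  fix x assume "x \<in> L i k"
  then have "\<forall>j\<in>I. (if j = i then x else 0) \<in> L j k"
    using assms(2) by (auto simp: graded_lie_def subspace_0)
  moreover have "x = (\<Sum>j\<in>I. if j = i then x else 0)"
    using assms(1,3) by simp
  ultimately show "x \<in> lie_sum I L k" unfolding lie_sum_def by blast
qed

lemma commutator_sum:
  "commutator (\<Sum>i\<in>I. u i) (\<Sum>j\<in>J. w j) = (\<Sum>i\<in>I. \<Sum>j\<in>J. commutator (u i) (w j))"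
  by (simp add: commutator_def sum_product sum_subtractf sum.swap[of _ J I])

lemma commutator_swap: "commutator x y = - commutator y x"
  by (simp add: commutator_def)

text \<open>By bilinearity, bracket one element of \<open>L i\<close> with one of
  \<open>L j\<close>. For \<open>i\<close> and \<open>j\<close> distinct the result falls into the
  algebra with the smaller index, after a change of sign if \<open>i < j\<close>.\<close>

lemma graded_lie_sum:
  fixes L :: "'i::linorder \<Rightarrow> nat \<Rightarrow> 'a::real_algebra set"
  assumes "finite I" "\<And>i. i \<in> I \<Longrightarrow> graded_lie (L i)"
    and acts: "\<And>i h. i \<in> I \<Longrightarrow> h \<in> I \<Longrightarrow> h < i \<Longrightarrow> lie_acts (L i) (L h)"
  shows "graded_lie (lie_sum I L)"
proof -
  have L: "subspace (L i k)" "lie_acts (L i) (L i)" if "i \<in> I" for i k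
    using assms(2)[OF that] by (auto simp: graded_lie_def)
  have sub: "subspace (lie_sum I L k)" for k
  proof (rule subspaceI)
    have "\<forall>i\<in>I. (0::'a) \<in> L i k" using L by (simp add: subspace_0)
    moreover have "0 = (\<Sum>i\<in>I. (0::'a))" by simp
    ultimately show "0 \<in> lie_sum I L k" unfolding lie_sum_def by blast
  next
    fix x y assume "x \<in> lie_sum I L k" "y \<in> lie_sum I L k"
    then obtain u w where "\<forall>i\<in>I. u i \<in> L i k" "x = (\<Sum>i\<in>I. u i)"
      "\<forall>i\<in>I. w i \<in> L i k" "y = (\<Sum>i\<in>I. w i)" by (auto simp: lie_sum_def)
    then have "\<forall>i\<in>I. u i + w i \<in> L i k" "x + y = (\<Sum>i\<in>I. u i + w i)"
      using L by (simp_all add: subspace_add sum.distrib)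
    then show "x + y \<in> lie_sum I L k" unfolding lie_sum_def by blast
  next
    fix c x assume "x \<in> lie_sum I L k"
    then obtain u where "\<forall>i\<in>I. u i \<in> L i k" "x = (\<Sum>i\<in>I. u i)" by (auto simp: lie_sum_def)
    then have "\<forall>i\<in>I. c *\<^sub>R u i \<in> L i k" "c *\<^sub>R x = (\<Sum>i\<in>I. c *\<^sub>R u i)"
      using L by (simp_all add: subspace_scale scaleR_sum_right)
    then show "c *\<^sub>R x \<in> lie_sum I L k" unfolding lie_sum_def by blast
  qed
  have "commutator x y \<in> lie_sum I L (p + q)"
    if xy: "x \<in> L i p" "y \<in> L j q" "i \<in> I" "j \<in> I" for x y i j p q
  proof -
    note sup = lie_sum_superset[OF assms(1,2), where k = "p + q", THEN subsetD]
    consider "i = j" | "j < i" | "i < j" by (rule linorder_cases)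
    then show ?thesis
    proof cases
      case 3
      then have "commutator y x \<in> L i (q + p)"
        using acts[of j i] xy unfolding lie_acts_def by blast
      then have "- commutator y x \<in> L i (p + q)"
        using L xy by (simp add: subspace_neg add.commute)
      then show ?thesis using sup xy by (simp add: commutator_swap[of x y])
    qed (use L acts xy sup in \<open>auto simp: lie_acts_def\<close>)
  qed
  then have "commutator x y \<in> lie_sum I L (p + q)"
    if "x \<in> lie_sum I L p" "y \<in> lie_sum I L q" for x y p q
    using that by (force simp: lie_sum_def[of I L p] lie_sum_def[of I L q] commutator_sum
        intro!: subspace_sum sub)
  with sub show ?thesis by (simp add: graded_lie_def lie_acts_def)
qed

lemma exp_group_mono:
  assumes "\<And>k. A k \<subseteq> B k"
  shows "exp_group A \<subseteq> exp_group B"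
  using assms unfolding exp_group_def lie_completion_def by blast

lemma exp_group_lie_sum_iff:
  fixes L :: "'i::linorder \<Rightarrow> nat \<Rightarrow> 'a::real_algebra_1 set"
  assumes "distinct js" "sorted js" "\<And>i. i \<in> set js \<Longrightarrow> graded_lie (L i)"
    and acts: "\<And>i h. i \<in> set js \<Longrightarrow> h \<in> set js \<Longrightarrow> h < i \<Longrightarrow> lie_acts (L i) (L h)"
  shows "S \<in> exp_group (lie_sum (set js) L) \<longleftrightarrow>
    (\<exists>T. (\<forall>i\<in>set js. T i \<in> exp_group (L i)) \<and> S = prod_list (map T js))"
proof
  let ?M = "lie_sum (set js) L"
  have M: "graded_lie ?M" using assms by (intro graded_lie_sum) auto
  {
    assume "S \<in> exp_group ?M"
    then obtain v where v: "fps_nth S 0 = 1" "v \<in> lie_completion ?M" "euler_deriv S = S * v"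
      by (auto simp: exp_group_iff[OF M])
    then have v0: "fps_nth v 0 = 0" and vk: "\<And>k. k \<ge> 1 \<Longrightarrow> fps_nth v k \<in> ?M k"
      by (auto simp: lie_completion_def)
    have "\<exists>u. (\<forall>i\<in>set js. u i \<in> L i k) \<and> fps_nth v k = (\<Sum>i\<in>set js. u i)" if "k \<ge> 1" for k
      using vk[OF that] by (auto simp: lie_sum_def)
    then obtain u where u: "\<And>k i. k \<ge> 1 \<Longrightarrow> i \<in> set js \<Longrightarrow> u k i \<in> L i k"
      "\<And>k. k \<ge> 1 \<Longrightarrow> fps_nth v k = (\<Sum>i\<in>set js. u k i)" by metis
    \<comment> \<open>\<open>u\<close> is only constrained for \<open>k >= 1\<close>; degree
      \<open>0\<close> is set to \<open>0\<close>, as \<open>lie_completion\<close> demands.\<close>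
    define w where "w i = Abs_fps (\<lambda>k. if k = 0 then 0 else u k i)" for i
    have w: "w i \<in> lie_completion (L i)" if "i \<in> set js" for i
      using u that by (simp add: w_def lie_completion_def)
    have vw: "v = (\<Sum>i\<in>set js. w i)"
    proof (rule fps_ext)
      show "fps_nth v k = fps_nth (\<Sum>i\<in>set js. w i) k" for k
        using u(2)[of k] v0 by (cases "k = 0") (simp_all add: fps_sum_nth w_def)
    qed
    have "sorted_wrt (\<lambda>h i. lie_acts (L i) (L h)) js"
      using assms(1,2) acts by (intro sorted_wrt_mono_rel[OF _ iffD2[OF strict_sorted_iff]]) auto
    then obtain T where "\<forall>i\<in>set js. T i \<in> exp_group (L i)" "fps_nth (prod_list (map T js)) 0 = 1"
      "euler_deriv (prod_list (map T js)) = prod_list (map T js) * v"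
      using exp_group_factor[of js L w] assms(1,3) w vw by blast
    moreover from this have "S = prod_list (map T js)"
      using v v0 euler_deriv_eq_mult_unique[of S v "prod_list (map T js)"] by simp
    ultimately show "\<exists>T. (\<forall>i\<in>set js. T i \<in> exp_group (L i)) \<and> S = prod_list (map T js)" by blast
  next
    assume "\<exists>T. (\<forall>i\<in>set js. T i \<in> exp_group (L i)) \<and> S = prod_list (map T js)"
    then obtain T where T: "\<forall>i\<in>set js. T i \<in> exp_group (L i)" "S = prod_list (map T js)" by blast
    have "T i \<in> exp_group ?M" if "i \<in> set js" for i
      using T(1) that exp_group_mono[of "L i" ?M] lie_sum_superset[of "set js" L i] assms(3) by auto
    \<comment> \<open>The induction runs over lists with entries in \<open>set js\<close>, so that
      \<open>?M\<close> stays fixed.\<close>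
    then have "prod_list (map T is) \<in> exp_group ?M" if "set is \<subseteq> set js" for "is"
      using that by (induction "is") (auto simp: one_in_exp_group mult_in_exp_group M)
    then show "S \<in> exp_group ?M" using T(2) by simp
  }
qed

section \<open>Substitution homomorphisms\<close>

lemma asfr_subst_superset:
  assumes "finite W" "Poly_Mapping.keys a \<subseteq> W"
  shows "asfr_subst f a = (\<Sum>w\<in>W. Poly_Mapping.lookup a w *\<^sub>R prod_list (map f (letters w)))"
  unfolding asfr_subst_def using assms
  by (intro sum.mono_neutral_left) (auto simp: in_keys_iff)

lemma linear_asfr_subst: "linear (asfr_subst f)"
proof (rule linearI)
  fix a b :: "'a asfr" and c :: real
  let ?W = "Poly_Mapping.keys a \<union> Poly_Mapping.keys b"
  show "asfr_subst f (a + b) = asfr_subst f a + asfr_subst f b"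
    using keys_add[of a b]
    by (simp add: asfr_subst_superset[of ?W] lookup_add scaleR_add_left sum.distrib)
  have "Poly_Mapping.keys (c *\<^sub>R a) \<subseteq> Poly_Mapping.keys a"
    by (auto simp: in_keys_iff lookup_scaleR_poly_mapping)
  then show "asfr_subst f (c *\<^sub>R a) = c *\<^sub>R asfr_subst f a"
    by (simp add: asfr_subst_superset[of "Poly_Mapping.keys a"] lookup_scaleR_poly_mapping
        scaleR_sum_right)
qed

lemma asfr_subst_single:
  "asfr_subst f (Poly_Mapping.single w c) = c *\<^sub>R prod_list (map f (letters w))"
  by (simp add: asfr_subst_def)

lemma asfr_subst_gen [simp]: "asfr_subst f (asfr_gen x) = f x"
  by (simp add: asfr_gen_def asfr_subst_single)

lemma asfr_subst_mult: "asfr_subst f (a * b) = asfr_subst f a * asfr_subst f b"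
proof (induction a rule: poly_mapping_induct)
  case (single v c)
  show ?case
  proof (induction b rule: poly_mapping_induct)
    case (single w d)
    then show ?case by (simp add: mult_single asfr_subst_single plus_free_monoid_def)
  next
    case (sum g h)
    then show ?case by (simp add: distrib_left linear_add[OF linear_asfr_subst])
  qed
next
  case (sum g h)
  then show ?case by (simp add: distrib_right linear_add[OF linear_asfr_subst])
qed

lemma asfr_subst_one: "asfr_subst f 1 = 1"
  unfolding single_one[symmetric] asfr_subst_single by (simp add: zero_free_monoid_def)

lemma asfr_subst_commutator:
  "asfr_subst f (commutator a b) = commutator (asfr_subst f a) (asfr_subst f b)"
  by (simp add: commutator_def linear_diff[OF linear_asfr_subst] asfr_subst_mult)

definition asfr_subst_fps :: "('x \<Rightarrow> 'u::real_algebra_1) \<Rightarrow> 'x asfr fps \<Rightarrow> 'u fps" where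
  "asfr_subst_fps f t = Abs_fps (\<lambda>p. asfr_subst f (fps_nth t p))"

lemma asfr_subst_fps_power: "asfr_subst_fps f (t ^ k) = asfr_subst_fps f t ^ k"
proof (induction k)
  case 0
  show ?case
    by (simp add: asfr_subst_fps_def fps_eq_iff asfr_subst_one linear_0[OF linear_asfr_subst])
next
  case (Suc k)
  have "asfr_subst_fps f (s * t) = asfr_subst_fps f s * asfr_subst_fps f t" for s t
    by (simp add: asfr_subst_fps_def fps_eq_iff fps_mult_nth linear_sum[OF linear_asfr_subst]
        asfr_subst_mult)
  with Suc show ?case by simp
qed

lemma asfr_subst_fps_series_exp: "asfr_subst_fps f (series_exp x) = series_exp (asfr_subst_fps f x)"
proof -
  have "asfr_subst f (fps_nth (x ^ k) p) = fps_nth (asfr_subst_fps f x ^ k) p" for k p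
    unfolding asfr_subst_fps_power[symmetric] by (simp add: asfr_subst_fps_def)
  then show ?thesis
    by (simp add: fps_eq_iff series_exp_def asfr_subst_fps_def[of f "Abs_fps _"]
        linear_sum[OF linear_asfr_subst] linear_scale[OF linear_asfr_subst])
qed

text \<open>A completion is a product of components, so preimages can be chosen independently in
  each degree; and substitution commutes with the exponential series.\<close>

lemma asfr_subst_fps_exp_group:
  "asfr_subst_fps f ` exp_group L = exp_group (\<lambda>k. asfr_subst f ` L k)"
proof -
  have "asfr_subst_fps f ` lie_completion L = lie_completion (\<lambda>k. asfr_subst f ` L k)"
  proof (intro equalityI subsetI)
    fix y assume "y \<in> lie_completion (\<lambda>k. asfr_subst f ` L k)"
    then have y: "fps_nth y 0 = 0" "\<And>k. k \<ge> 1 \<Longrightarrow> \<exists>a\<in>L k. fps_nth y k = asfr_subst f a"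
      by (auto simp: lie_completion_def)
    then obtain a where a: "\<And>k. k \<ge> 1 \<Longrightarrow> a k \<in> L k \<and> fps_nth y k = asfr_subst f (a k)"
      by metis
    define x where "x = Abs_fps (\<lambda>k. if k = 0 then 0 else a k)"
    have "y = asfr_subst_fps f x"
      using a y(1) by (auto simp: fps_eq_iff asfr_subst_fps_def x_def linear_0[OF linear_asfr_subst])
    moreover have "x \<in> lie_completion L" using a by (simp add: x_def lie_completion_def)
    ultimately show "y \<in> asfr_subst_fps f ` lie_completion L" by blast
  qed (auto simp: lie_completion_def asfr_subst_fps_def linear_0[OF linear_asfr_subst])
  then have "exp_group (\<lambda>k. asfr_subst f ` L k)
      = (\<lambda>x. series_exp (asfr_subst_fps f x)) ` lie_completion L"
    unfolding exp_group_def by (metis image_image)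
  then show ?thesis by (simp add: exp_group_def image_image asfr_subst_fps_series_exp)
qed

lemma graded_lie_asfr_subst:
  assumes "graded_lie L"
  shows "graded_lie (\<lambda>k. asfr_subst f ` L k)"
  using assms
  by (auto simp: graded_lie_def lie_acts_def asfr_subst_commutator[symmetric]
      intro!: linear_subspace_image linear_asfr_subst)

section \<open>Graded pieces of the free Lie algebra\<close>

lemma graded_lie_free_lie_comp: "graded_lie (free_lie_comp X)"
proof -
  have "subspace (asfr_homogeneous k :: 'a asfr set)" for k
    using keys_add by (fastforce simp: subspace_def asfr_homogeneous_def in_keys_iff
        lookup_scaleR_poly_mapping)
  moreover have "a * b \<in> asfr_homogeneous (i + j)"
    if "a \<in> asfr_homogeneous i" "b \<in> asfr_homogeneous j" for a b :: "'a asfr" and i j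
    using that keys_mult[of a b] by (fastforce simp: asfr_homogeneous_def plus_free_monoid_def)
  ultimately show ?thesis
    using lie_subalgebra_free_lie[of X]
    by (fastforce simp: graded_lie_def lie_acts_def free_lie_comp_def lie_subalgebra_def commutator_def
        add.commute intro: subspace_inter subspace_diff)
qed

lemma asfr_gen_in_free_lie_comp: "x \<in> X \<Longrightarrow> asfr_gen x \<in> free_lie_comp X 1"
  by (simp add: free_lie_comp_def asfr_gen_in_free_lie) (simp add: asfr_homogeneous_def asfr_gen_def)

lemma free_lie_comp_mono: "X \<subseteq> Y \<Longrightarrow> free_lie_comp X k \<subseteq> free_lie_comp Y k"
  unfolding free_lie_comp_def free_lie_def using hull_mono[of "asfr_gen ` X" "asfr_gen ` Y" lie_subalgebra] by blast

text \<open>Serves as induction over brackets, with \<open>Q\<close> a family of well-behaved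
  elements. The hull \<open>free_lie X\<close> is not built by degrees, so the closure argument
  covers all its elements and degree \<open>m\<close> is extracted at the end.\<close>

lemma asfr_subst_free_lie_comp_mem:
  assumes Q: "graded_lie Q" "\<And>x. x \<in> X \<Longrightarrow> f x \<in> Q 1" and a: "a \<in> free_lie_comp X m"
  shows "asfr_subst f a \<in> Q m"
proof -
  \<comment> \<open>The power series variable records degrees, so \<open>\<psi>\<close> splits the image of \<open>a\<close> into graded parts.\<close>
  define \<psi> where "\<psi> = asfr_subst (\<lambda>x. fps_const (f x) * fps_X)"
  have lin: "linear \<psi>" unfolding \<psi>_def by (rule linear_asfr_subst)
  have sub: "subspace (Q k)" for k using Q by (simp add: graded_lie_def)
  define H where "H = {a. \<forall>k. fps_nth (\<psi> a) k \<in> Q k}"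
  have "lie_subalgebra H"
    unfolding lie_subalgebra_def
  proof
    show "subspace H"
      unfolding subspace_def H_def
      by (simp add: linear_0[OF lin] linear_add[OF lin] linear_scale[OF lin]
          subspace_0 subspace_add subspace_scale sub)
    show "\<forall>x\<in>H. \<forall>y\<in>H. commutator x y \<in> H"
    proof (intro ballI)
      fix x y assume xy: "x \<in> H" "y \<in> H"
      have "commutator (fps_nth (\<psi> x) i) (fps_nth (\<psi> y) (k - i)) \<in> Q k" if "i \<le> k" for i k
        using Q(1) xy that unfolding graded_lie_def lie_acts_def H_def
        by (metis (mono_tags, lifting) le_add_diff_inverse mem_Collect_eq)
      then show "commutator x y \<in> H"
        by (auto simp: H_def \<psi>_def asfr_subst_commutator commutator_nth intro!: subspace_sum sub)
    qed
  qed
  moreover have "asfr_gen ` X \<subseteq> H"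
    using Q(2) by (auto simp: H_def \<psi>_def subspace_0[OF sub] fps_X_def)
  ultimately have "free_lie X \<subseteq> H"
    unfolding free_lie_def by (rule hull_minimal[rotated])
  with a have "fps_nth (\<psi> a) m \<in> Q m" by (auto simp: H_def free_lie_comp_def)
  \<comment> \<open>A word of length \<open>l\<close> goes to its image times
    \<open>fps_X ^ l\<close>, so for \<open>a\<close> homogeneous of degree \<open>m\<close> the
    coefficient \<open>m\<close> is the whole image.\<close>
  moreover have "fps_nth (prod_list (map (\<lambda>x. fps_const (f x) * fps_X) ls)) k
      = (if k = length ls then prod_list (map f ls) else 0)" for ls k
    by (induction ls arbitrary: k) (auto simp: mult.assoc)
  then have "fps_nth (\<psi> a) m = asfr_subst f a"
    using a unfolding \<psi>_def asfr_subst_def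
    by (auto simp: fps_sum_nth free_lie_comp_def asfr_homogeneous_def intro!: sum.cong)
  ultimately show ?thesis by simp
qed

section \<open>Normalizers\<close>

lemma commutator_jacobi:
  "commutator x (commutator y z) = commutator (commutator x y) z + commutator y (commutator x z)"
  by (simp add: commutator_def algebra_simps)

lemma commutator_linear [simp]:
  fixes x y z :: "'a::real_algebra"
  shows "commutator (x + y) z = commutator x z + commutator y z"
    and "commutator x (y + z) = commutator x y + commutator x z"
    and "commutator 0 z = 0" "commutator x 0 = 0"
    and "commutator (c *\<^sub>R x) z = c *\<^sub>R commutator x z"
    and "commutator x (c *\<^sub>R z) = c *\<^sub>R commutator x z"
  by (simp_all add: commutator_def algebra_simps)

definition lie_normalizer :: "(nat \<Rightarrow> 'a::ring set) \<Rightarrow> nat \<Rightarrow> 'a set" where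
  "lie_normalizer A m = {u. \<forall>p. \<forall>a\<in>A p. commutator u a \<in> A (m + p)}"

text \<open>Jacobi: \<open>[[x, y], a] = [x, [y, a]] - [y, [x, a]]\<close>.\<close>

lemma graded_lie_normalizer:
  assumes A: "graded_lie A"
  shows "graded_lie (lie_normalizer A)"
proof -
  have sub: "subspace (A k)" for k using A by (simp add: graded_lie_def)
  have "commutator (commutator x y) a \<in> A (i + j + p)"
    if "x \<in> lie_normalizer A i" "y \<in> lie_normalizer A j" "a \<in> A p" for x y a i j p
  proof -
    have "commutator x (commutator y a) \<in> A (i + (j + p))"
      "commutator y (commutator x a) \<in> A (j + (i + p))"
      using that by (auto simp: lie_normalizer_def)
    then have "commutator x (commutator y a) - commutator y (commutator x a) \<in> A (i + j + p)"
      by (intro subspace_diff sub) (simp_all add: ac_simps)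
    then show ?thesis by (simp add: commutator_jacobi[of x y a])
  qed
  then show ?thesis
    by (auto simp: graded_lie_def lie_acts_def lie_normalizer_def subspace_def
        subspace_0[OF sub] subspace_add[OF sub] subspace_scale[OF sub])
qed

text \<open>\<open>ad r\<close> is a derivation. Hence whether \<open>r\<close> normalizes
  \<open>A\<close> can be tested on generators of \<open>A\<close>.\<close>

lemma graded_lie_adjoint:
  assumes A: "graded_lie A"
  shows "graded_lie (\<lambda>m. {u \<in> A m. commutator r u \<in> A (Suc m)})"
proof -
  have sub: "subspace (A k)" and br: "\<And>x y i j. x \<in> A i \<Longrightarrow> y \<in> A j \<Longrightarrow> commutator x y \<in> A (i + j)"
    for k using A by (auto simp: graded_lie_def lie_acts_def)
  have "commutator r (commutator x y) \<in> A (Suc (i + j))"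
    if "x \<in> A i" "commutator r x \<in> A (Suc i)" "y \<in> A j" "commutator r y \<in> A (Suc j)" for x y i j
    unfolding commutator_jacobi[of r]
    using br[OF that(2,3)] br[OF that(1,4)] by (intro subspace_add sub) simp_all
  then show ?thesis
    by (auto simp: graded_lie_def lie_acts_def br subspace_def
        subspace_0[OF sub] subspace_add[OF sub] subspace_scale[OF sub])
qed

section \<open>The Kohno algebra inside its enveloping algebra\<close>

lemma envel_rel_if_relator: "a - b \<in> envel_relators \<Longrightarrow> envel_rel a b"
proof -
  assume "a - b \<in> envel_relators"
  then have "1 * (a - b) * 1 \<in> {a * r * b |a r b. r \<in> envel_relators}" by blast
  from span_base[OF this] show "envel_rel a b"
    by (simp add: envel_rel_def two_sided_ideal_def)
qed

lemma linear_envel_of: "linear envel_of"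
proof (rule linearI)
  show "envel_of (x + y) = envel_of x + envel_of y" for x y :: 'a
    by transfer (rule envel_rel_if_relator, simp add: envel_relators_def diff_diff_eq[symmetric], blast)
  show "envel_of (c *\<^sub>R x) = c *\<^sub>R envel_of x" for c and x :: 'a
    by transfer (rule envel_rel_if_relator, simp add: envel_relators_def, blast)
qed

definition kohno_r :: "nat \<Rightarrow> nat \<Rightarrow> 'n kohno envel" where
  "kohno_r i j = envel_of (kohno_gen i j)"

abbreviation kohno_subst :: "(nat \<times> nat) asfr \<Rightarrow> 'n kohno envel" where
  "kohno_subst \<equiv> asfr_subst (\<lambda>(i, j). kohno_r i j)"

lemma kohno_r_relations:
  fixes i j k l :: nat
  shows "\<lbrakk>{i, j} \<subseteq> {1..CARD('n)}; i \<noteq> j\<rbrakk> \<Longrightarrow> (kohno_r i j :: 'n kohno envel) = kohno_r j i"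
    and "\<lbrakk>{i, j, k, l} \<subseteq> {1..CARD('n)}; distinct [i, j, k, l]\<rbrakk>
      \<Longrightarrow> commutator (kohno_r i j) (kohno_r k l :: 'n kohno envel) = 0"
    and "\<lbrakk>{i, j, k} \<subseteq> {1..CARD('n)}; distinct [i, j, k]\<rbrakk>
      \<Longrightarrow> commutator (kohno_r i j) (kohno_r i k + kohno_r j k :: 'n kohno envel) = 0"
  unfolding kohno_r_def linear_add[OF linear_envel_of, symmetric] envel_of_bracket[symmetric]
  by (rule arg_cong[where f = envel_of], erule (1) kohno_gen_relations(1))
    (simp_all only: kohno_gen_relations(2,3) linear_0[OF linear_envel_of])

text \<open>Both sides are Lie homomorphisms in \<open>a\<close> agreeing on the letters, and the
  set where they agree is a Lie subalgebra.\<close>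

lemma kohno_subst_eq_envel_of:
  assumes "a \<in> kohno_free CARD('n)"
  shows "kohno_subst a = envel_of (kohno_class a :: 'n kohno)"
proof -
  let ?F = "kohno_free CARD('n)"
  let ?G = "{a \<in> ?F. kohno_subst a = envel_of (kohno_class a :: 'n kohno)}"
  note lin = linear_0[OF linear_asfr_subst] linear_add[OF linear_asfr_subst]
    linear_scale[OF linear_asfr_subst] linear_0[OF linear_envel_of] linear_add[OF linear_envel_of]
    linear_scale[OF linear_envel_of]
  note F = subspace_0[OF subspace_kohno_free] subspace_add[OF subspace_kohno_free]
    subspace_scale[OF subspace_kohno_free] commutator_kohno_free
  have "lie_subalgebra ?G"
    by (auto simp: lie_subalgebra_def subspace_def lin F asfr_subst_commutator
        kohno_class_ops[symmetric] zero_kohno_def[symmetric] envel_of_bracket)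
  moreover have "asfr_gen ` kohno_letters CARD('n) \<subseteq> ?G"
    by (auto simp: asfr_gen_in_free_lie kohno_r_def kohno_gen_def)
  ultimately have "?F \<subseteq> ?G" unfolding free_lie_def[of "kohno_letters CARD('n)"]
    by (rule hull_minimal[rotated])
  with assms show ?thesis by blast
qed

section \<open>The rows of Kohno generators and their action on one another\<close>

abbreviation kohno_row :: "'n itself \<Rightarrow> nat \<Rightarrow> (nat \<times> nat) set" where
  "kohno_row _ j \<equiv> {(j, k) |k. j < k \<and> k \<le> CARD('n)}"

definition kohno_row_lie :: "nat \<Rightarrow> nat \<Rightarrow> 'n kohno envel set" where
  "kohno_row_lie j m = kohno_subst ` free_lie_comp (kohno_row TYPE('n) j) m"

lemma Fr_in_kohno_eq: "(Fr_in_kohno j :: 'n kohno envel fps set) = exp_group (kohno_row_lie j)"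
  unfolding Fr_in_kohno_def Fr_group_def kohno_row_lie_def asfr_subst_fps_exp_group[symmetric]
  by (simp add: asfr_to_kohno_def asfr_subst_fps_def kohno_r_def[abs_def])

lemma Br_group_eq:
  "(Br_group :: 'n kohno envel fps set)
    = exp_group (\<lambda>k. kohno_subst ` free_lie_comp (kohno_letters CARD('n)) k)"
proof -
  have "envel_of ` (kohno_comp k :: 'n kohno set)
      = kohno_subst ` free_lie_comp (kohno_letters CARD('n)) k" for k
    unfolding kohno_comp_def image_image
    by (rule image_cong) (auto simp: free_lie_comp_def kohno_subst_eq_envel_of)
  then show ?thesis by (simp add: Br_group_def)
qed

lemma graded_lie_kohno_row_lie: "graded_lie (kohno_row_lie j)"
  unfolding kohno_row_lie_def[abs_def] by (intro graded_lie_asfr_subst graded_lie_free_lie_comp)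

lemma kohno_r_in_kohno_row_lie:
  "j < k \<Longrightarrow> k \<le> CARD('n) \<Longrightarrow> (kohno_r j k :: 'n kohno envel) \<in> kohno_row_lie j 1"
  unfolding kohno_row_lie_def
  by (rule image_eqI[of _ _ "asfr_gen (j, k)"]) (auto intro: asfr_gen_in_free_lie_comp[unfolded One_nat_def])

text \<open>The relations give \<open>[r_jk, r_ij] = [r_ij, r_ik]\<close> and
  \<open>[r_jk, r_ik] = [r_ik, r_ij]\<close>; for any other \<open>l\<close> the four indices are
  distinct and the bracket is zero.\<close>

lemma kohno_r_commutator_row:
  assumes "1 \<le> i" "i < j" "j < k" "k \<le> CARD('n)" "i < l" "l \<le> CARD('n)"
  shows "commutator (kohno_r j k) (kohno_r i l :: 'n kohno envel) \<in> kohno_row_lie i 2"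
proof -
  let ?r = "kohno_r :: nat \<Rightarrow> nat \<Rightarrow> 'n kohno envel"
  let ?A = "kohno_row_lie i :: nat \<Rightarrow> 'n kohno envel set"
  have "graded_lie ?A" by (rule graded_lie_kohno_row_lie)
  then have sub: "subspace (?A 2)" and acts: "lie_acts ?A ?A" by (simp_all add: graded_lie_def)
  have "?r i p \<in> ?A 1" if "p \<in> {j, k}" for p
    using that assms by (intro kohno_r_in_kohno_row_lie) auto
  then have "commutator (?r i p) (?r i q) \<in> ?A (1 + 1)" if "p \<in> {j, k}" "q \<in> {j, k}" for p q
    using acts that unfolding lie_acts_def by blast
  then have br: "commutator (?r i p) (?r i q) \<in> ?A 2" if "p \<in> {j, k}" "q \<in> {j, k}" for p q
    using that by (simp add: numeral_2_eq_2)
  consider "l = j" | "l = k" | "l \<noteq> j" "l \<noteq> k" by blast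
  then show ?thesis
  proof cases
    case 1
    have "commutator (?r i j) (?r i k + ?r j k) = 0"
      using assms by (intro kohno_r_relations) auto
    then have "commutator (?r j k) (?r i j) = commutator (?r i j) (?r i k)"
      by (simp add: commutator_def algebra_simps)
    then show ?thesis using br 1 by simp
  next
    case 2
    have "commutator (?r i k) (?r i j + ?r k j) = 0"
      using assms by (intro kohno_r_relations) auto
    moreover have "?r k j = ?r j k" using assms by (intro kohno_r_relations) auto
    ultimately have "commutator (?r j k) (?r i k) = commutator (?r i k) (?r i j)"
      by (simp add: commutator_def algebra_simps)
    then show ?thesis using br 2 by simp
  next
    case 3
    then have "commutator (?r j k) (?r i l) = 0"
      using assms by (intro kohno_r_relations) auto
    then show ?thesis using sub by (simp add: subspace_0)
  qed
qed

text \<open>Two passages from generators to brackets: \<open>graded_lie_adjoint\<close> extends the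
  previous lemma to all of row \<open>i\<close> for a fixed \<open>r_jk\<close>, then
  \<open>graded_lie_normalizer\<close> extends it to all of row \<open>j\<close>.\<close>

lemma lie_acts_kohno_row_lie:
  assumes "1 \<le> i" "i < j"
  shows "lie_acts (kohno_row_lie j) (kohno_row_lie i :: nat \<Rightarrow> 'n kohno envel set)"
proof -
  let ?A = "kohno_row_lie i :: nat \<Rightarrow> 'n kohno envel set"
  have A: "graded_lie ?A" by (rule graded_lie_kohno_row_lie)
  have norm: "kohno_r j k \<in> lie_normalizer ?A 1" if k: "j < k" "k \<le> CARD('n)" for k
  proof -
    have "a \<in> {u \<in> ?A p. commutator (kohno_r j k) u \<in> ?A (Suc p)}" if a: "a \<in> ?A p" for a p
    proof -
      obtain b where b: "a = kohno_subst b" "b \<in> free_lie_comp (kohno_row TYPE('n) i) p"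
        using a by (auto simp: kohno_row_lie_def)
      show ?thesis
        unfolding b(1) using assms k
        by (intro asfr_subst_free_lie_comp_mem[OF graded_lie_adjoint[OF A] _ b(2)])
          (auto simp: kohno_r_commutator_row kohno_r_in_kohno_row_lie[unfolded One_nat_def]
             numeral_2_eq_2[symmetric])
    qed
    then show ?thesis by (simp add: lie_normalizer_def)
  qed
  have "u \<in> lie_normalizer ?A m" if "u \<in> kohno_row_lie j m" for u :: "'n kohno envel" and m
    using that norm unfolding kohno_row_lie_def[of j]
    by (auto intro!: asfr_subst_free_lie_comp_mem[OF graded_lie_normalizer[OF A], rotated])
  then show ?thesis by (auto simp: lie_acts_def lie_normalizer_def)
qed

text \<open>The sum of the rows is a graded Lie algebra containing all generators in degree
  \<open>1\<close>, hence everything; conversely each row uses only Kohno letters.\<close>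

lemma kohno_subst_eq_lie_sum:
  "kohno_subst ` free_lie_comp (kohno_letters CARD('n)) m
    = (lie_sum {1..<CARD('n)} kohno_row_lie m :: 'n kohno envel set)"
proof (intro equalityI subsetI)
  let ?M = "lie_sum {1..<CARD('n)} kohno_row_lie :: nat \<Rightarrow> 'n kohno envel set"
  fix x :: "'n kohno envel"
  {
    assume "x \<in> kohno_subst ` free_lie_comp (kohno_letters CARD('n)) m"
    then obtain a where a: "x = kohno_subst a" "a \<in> free_lie_comp (kohno_letters CARD('n)) m"
      by blast
    have lt: "kohno_r i j \<in> ?M 1" if "1 \<le> i" "i < j" "j \<le> CARD('n)" for i j
    proof (rule subsetD)
      show "kohno_row_lie i 1 \<subseteq> ?M 1"
        using that by (intro lie_sum_superset graded_lie_kohno_row_lie) auto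
      show "kohno_r i j \<in> (kohno_row_lie i 1 :: 'n kohno envel set)"
        using that by (intro kohno_r_in_kohno_row_lie)
    qed
    \<comment> \<open>Letters with \<open>i > j\<close> lie in no row; they are reduced by
      \<open>r_ij = r_ji\<close>.\<close>
    have "kohno_r i j \<in> ?M 1" if "(i, j) \<in> kohno_letters CARD('n)" for i j
    proof (cases "i < j")
      case False
      then have "kohno_r i j = (kohno_r j i :: 'n kohno envel)"
        using that by (intro kohno_r_relations) (auto simp: kohno_letters_def)
      then show ?thesis using lt[of j i] that False by (auto simp: kohno_letters_def)
    qed (use lt that in \<open>auto simp: kohno_letters_def\<close>)
    then show "x \<in> ?M m"
      unfolding a(1) using lie_acts_kohno_row_lie graded_lie_kohno_row_lie
      by (intro asfr_subst_free_lie_comp_mem[OF graded_lie_sum _ a(2)]) auto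
  next
    assume "x \<in> ?M m"
    then obtain u where u: "x = (\<Sum>i\<in>{1..<CARD('n)}. u i)" "\<forall>i\<in>{1..<CARD('n)}. u i \<in> kohno_row_lie i m"
      by (auto simp: lie_sum_def)
    have "kohno_row_lie i m \<subseteq>
        (kohno_subst ` free_lie_comp (kohno_letters CARD('n)) m :: 'n kohno envel set)"
      if "i \<in> {1..<CARD('n)}" for i
      unfolding kohno_row_lie_def using that
      by (intro image_mono free_lie_comp_mono) (auto simp: kohno_letters_def)
    moreover have "subspace (kohno_subst ` free_lie_comp (kohno_letters CARD('n)) m :: 'n kohno envel set)"
      using graded_lie_asfr_subst[OF graded_lie_free_lie_comp] unfolding graded_lie_def by blast
    ultimately show "x \<in> kohno_subst ` free_lie_comp (kohno_letters CARD('n)) m"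
      unfolding u(1) using u(2) by (intro subspace_sum) blast+
  }
qed

theorem theorem3p3:
  fixes S :: "'n::finite kohno envel fps"
  assumes "CARD('n) \<ge> 2"
    and "S \<in> kohno_envel_completion"
  shows "S \<in> Br_group \<longleftrightarrow>
    (\<exists>T :: nat \<Rightarrow> 'n kohno envel fps.
       (\<forall>j\<in>{1..<CARD('n)}. T j \<in> Fr_in_kohno j) \<and>
       S = prod_list (map T [1..<CARD('n)]))"
proof -
  \<comment> \<open>In increasing order, the algebra of each factor is acted on by those of the
    factors to its right.\<close>
  have "S \<in> exp_group (lie_sum (set [1..<CARD('n)]) kohno_row_lie) \<longleftrightarrow>
      (\<exists>T. (\<forall>j\<in>set [1..<CARD('n)]. T j \<in> exp_group (kohno_row_lie j)) \<and>
        S = prod_list (map T [1..<CARD('n)]))"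
    by (rule exp_group_lie_sum_iff)
      (auto simp: graded_lie_kohno_row_lie intro: lie_acts_kohno_row_lie)
  then show ?thesis by (simp add: Br_group_eq Fr_in_kohno_eq kohno_subst_eq_lie_sum)
qed

end
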